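(* Suppose that (A1) for all $b,b'\in\mathcal B$, $\phi(b,t)-\phi(b',t)$ is single-crossing in $t$ and $v(b,t)-v(b',t)$ is monotonic in $t$; (A2) for all $a,a'\in\Delta(\mathcal B)$, $\phi(a,t)-\phi(a',t)$ is single-crossing in $t$; and for all $b\subseteq b'$ in $\mathcal B$, $v(b',\bar t)\ge v(b,\bar t)$. If the union quantity condition holds, i.e. $$Q(b_1\cup b_2)\ge\min\{Q(b_1),Q(b_2)\}\quad\text{for all }b_1,b_2\in\mathcal B,$$ then the minimal optimal menu of the monopolist's problem is nested. In addition, $$\{\emptyset,\ b_1^\star,\ b_1^\star\cup b_2^\star,\ \dots,\ b^*\}$$ is an optimal menu, where $\{b_1^\star,\dots,b_{2^n}^\star\}=\mathcal B$ is ordered by the sold-alone quantity, that is, $Q(b_i^\star)\ge Q(b_j^\star)$ for all $i\le j$, and $b^*=\{1,\dots,n\}=b_1^\star\cup\dots\cup b_{2^n}^\star$ is the grand bundle.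
   Context: Setup. There are $n$ goods; $\mathcal B=2^{\{1,\dots,n\}}$ is the set of (deterministic) bundles and $\Delta(\mathcal B)$ is the set of probability distributions on $\mathcal B$ (stochastic bundles); a bundle $b$ is identified with the point mass at $b$. Types $t$ lie in $T=[\underline t,\bar t]\subseteq\mathbb R$ and are distributed according to $F$ with a continuous, positive density $f$. The value function $v:\Delta(\mathcal B)\times T\to\mathbb R$ is continuously differentiable in $t$, with $v(\emptyset,t)=0$ for all $t$ and $v(a,t)=\mathbb E_{b\sim a}[v(b,t)]$. The virtual value function is $\phi(b,t)=v(b,t)-\frac{1-F(t)}{f(t)}v_t(b,t)$, $v_t=\partial v/\partial t$, extended by $\phi(a,t)=\mathbb E_{b\sim a}[\phi(b,t)]$ for $a\in\Delta(\mathcal B)$; note $\phi(b,\bar t)=v(b,\bar t)$. Standing assumptions: for $b\ne b'$ in $\mathcal B$ there is $t\in T$ with $\phi(b,t)\neq\phi(b',t)$; $\max_{b\neq\emptyset}\phi(b,\underline t)<0=\phi(\emptyset,\underline t)$; and $v(b,\bar t)>0$ for all $b\ne\emptyset$. Sold-alone quantity. The sold-alone quantity of a bundle $b$ is $Q(b)=1-F(t_b)\in[0,1]$, where $t_b\in T$ satisfies $\phi(b,t_b)=0$; it is the quantity sold by a revenue-maximizing monopolist who sells only $b$. For $b\neq\emptyset$ such a $t_b$ exists by the standing assumptions and continuity of $\phi$ (it is unique if, for example, the single-crossing in (A1) holds in the strict sense). Terminology. A function $g:T\to\mathbb R$ is single-crossing in $t$ if $\operatorname{sign}[g(t)]\in\{-1,0,1\}$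 is a monotonic function of $t$. "Monotonic" means either (weakly) increasing or (weakly) decreasing on $T$. Monopolist's problem. A mechanism is a measurable map $(a,p):T\to\Delta(\mathcal B)\times\mathbb R$. It is IC if $v(a(t),t)-p(t)\ge v(a(t'),t)-p(t')$ for all $t,t'\in T$, and IR if $v(a(t),t)-p(t)\ge 0$ for all $t\in T$. The monopolist maximizes $\mathbb E[p(t)]$ over IC and IR mechanisms. A menu $B\subseteq\mathcal B$ is optimal if there is an optimal mechanism $(a,p)$ with $a(t)\in B$ for all $t$; an optimal menu $B$ is a minimal optimal menu if no $B'\subsetneq B$ is optimal. (Under (A1) and (A2) the minimal optimal menu is unique.) A menu is nested if any two of its bundles are ordered by set inclusion. *)

theory Defs
  imports "HOL-Probability.Probability"
begin

definition bundles :: "nat \<Rightarrow> nat set set" where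
  "bundles n = Pow {1..n}"

definition stochastic_bundles :: "nat \<Rightarrow> nat set pmf set" where
  "stochastic_bundles n = {a. set_pmf a \<subseteq> bundles n}"

(* The affine extension of a function on (bundles x types) to stochastic bundles. It is how the
   value function and the virtual value function are evaluated at a stochastic bundle; a bundle b
   is identified with the point mass "return_pmf b", at which the extension equals "g b t". *)
definition expected :: "(nat set \<Rightarrow> real \<Rightarrow> real) \<Rightarrow> nat set pmf \<Rightarrow> real \<Rightarrow> real" where
  "expected g a t = measure_pmf.expectation a (\<lambda>b. g b t)"

definition type_dist :: "real \<Rightarrow> real \<Rightarrow> (real \<Rightarrow> real) \<Rightarrow> real measure" where
  "type_dist lo hi f = density lborel (\<lambda>t. ennreal (f t * indicator {lo..hi} t))"

(* Relative to the type space, so the derivative is one-sided at the two end points. *)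
definition type_deriv :: "real \<Rightarrow> real \<Rightarrow> (real \<Rightarrow> real) \<Rightarrow> real \<Rightarrow> real" where
  "type_deriv lo hi g t = vector_derivative g (at t within {lo..hi})"

definition virtual_value ::
  "real \<Rightarrow> real \<Rightarrow> (real \<Rightarrow> real) \<Rightarrow> (nat set \<Rightarrow> real \<Rightarrow> real) \<Rightarrow> nat set \<Rightarrow> real \<Rightarrow> real" where
  "virtual_value lo hi f v b t =
     v b t - (1 - cdf (type_dist lo hi f) t) / f t * type_deriv lo hi (v b) t"

locale bundling_environment =
  fixes n :: nat
    and lo hi :: real
    and f :: "real \<Rightarrow> real"
    and v :: "nat set \<Rightarrow> real \<Rightarrow> real"
  assumes lo_less_hi: "lo < hi"
    and density_continuous: "continuous_on {lo..hi} f"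
    and density_pos: "\<forall>t\<in>{lo..hi}. f t > 0"
    and density_prob: "prob_space (type_dist lo hi f)"
    and value_differentiable: "\<forall>b\<in>bundles n. v b differentiable_on {lo..hi}"
    and value_C1: "\<forall>b\<in>bundles n. continuous_on {lo..hi} (type_deriv lo hi (v b))"
    and value_empty: "\<forall>t\<in>{lo..hi}. v {} t = 0"
    and virtual_value_distinct: "\<forall>b\<in>bundles n. \<forall>b'\<in>bundles n. b \<noteq> b' \<longrightarrow>
          (\<exists>t\<in>{lo..hi}. virtual_value lo hi f v b t \<noteq> virtual_value lo hi f v b' t)"
    and virtual_value_lo_neg: "\<forall>b\<in>bundles n - {{}}. virtual_value lo hi f v b lo < 0"
    and value_hi_pos: "\<forall>b\<in>bundles n - {{}}. v b hi > 0"

definition monotonic_on :: "real set \<Rightarrow> (real \<Rightarrow> real) \<Rightarrow> bool" where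
  "monotonic_on T g \<longleftrightarrow> mono_on T g \<or> antimono_on T g"

definition single_crossing_on :: "real set \<Rightarrow> (real \<Rightarrow> real) \<Rightarrow> bool" where
  "single_crossing_on T g \<longleftrightarrow> monotonic_on T (\<lambda>t. sgn (g t))"

(* "q is a sold-alone quantity of b". A relation rather than a function: the zero of the virtual
   value need not be unique, and for the empty bundle every type is a zero. *)
definition sold_alone_quantity ::
  "real \<Rightarrow> real \<Rightarrow> (real \<Rightarrow> real) \<Rightarrow> (nat set \<Rightarrow> real \<Rightarrow> real) \<Rightarrow> nat set \<Rightarrow> real \<Rightarrow> bool" where
  "sold_alone_quantity lo hi f v b q \<longleftrightarrow>
     (\<exists>t\<in>{lo..hi}. virtual_value lo hi f v b t = 0 \<and> q = 1 - cdf (type_dist lo hi f) t)"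

(* Measurability of the allocation is with respect to the Borel sets of the finite-dimensional
   simplex of stochastic bundles, that is, coordinatewise. *)
definition mechanism :: "nat \<Rightarrow> real \<Rightarrow> real \<Rightarrow> (real \<Rightarrow> nat set pmf) \<Rightarrow> (real \<Rightarrow> real) \<Rightarrow> bool" where
  "mechanism n lo hi a p \<longleftrightarrow>
     (\<forall>t\<in>{lo..hi}. a t \<in> stochastic_bundles n) \<and>
     (\<forall>b\<in>bundles n. (\<lambda>t. pmf (a t) b) \<in> borel_measurable (restrict_space borel {lo..hi})) \<and>
     p \<in> borel_measurable (restrict_space borel {lo..hi})"

definition incentive_compatible ::
  "real \<Rightarrow> real \<Rightarrow> (nat set \<Rightarrow> real \<Rightarrow> real) \<Rightarrow> (real \<Rightarrow> nat set pmf) \<Rightarrow> (real \<Rightarrow> real) \<Rightarrow> bool" where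
  "incentive_compatible lo hi v a p \<longleftrightarrow>
     (\<forall>t\<in>{lo..hi}. \<forall>t'\<in>{lo..hi}. expected v (a t) t - p t \<ge> expected v (a t') t - p t')"

definition individually_rational ::
  "real \<Rightarrow> real \<Rightarrow> (nat set \<Rightarrow> real \<Rightarrow> real) \<Rightarrow> (real \<Rightarrow> nat set pmf) \<Rightarrow> (real \<Rightarrow> real) \<Rightarrow> bool" where
  "individually_rational lo hi v a p \<longleftrightarrow> (\<forall>t\<in>{lo..hi}. expected v (a t) t - p t \<ge> 0)"

definition feasible_mechanism ::
  "nat \<Rightarrow> real \<Rightarrow> real \<Rightarrow> (nat set \<Rightarrow> real \<Rightarrow> real) \<Rightarrow> (real \<Rightarrow> nat set pmf) \<Rightarrow> (real \<Rightarrow> real) \<Rightarrow> bool" where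
  "feasible_mechanism n lo hi v a p \<longleftrightarrow>
     mechanism n lo hi a p \<and> incentive_compatible lo hi v a p \<and> individually_rational lo hi v a p"

(* On feasible mechanisms the integrand is bounded on the type space (by IC and IR, because the
   values are bounded), so the default value 0 of a non-existing integral plays no role. *)
definition revenue :: "real \<Rightarrow> real \<Rightarrow> (real \<Rightarrow> real) \<Rightarrow> (real \<Rightarrow> real) \<Rightarrow> real" where
  "revenue lo hi f p = (LINT t:{lo..hi}|type_dist lo hi f. p t)"

definition optimal_mechanism ::
  "nat \<Rightarrow> real \<Rightarrow> real \<Rightarrow> (real \<Rightarrow> real) \<Rightarrow> (nat set \<Rightarrow> real \<Rightarrow> real) \<Rightarrow>
     (real \<Rightarrow> nat set pmf) \<Rightarrow> (real \<Rightarrow> real) \<Rightarrow> bool" where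
  "optimal_mechanism n lo hi f v a p \<longleftrightarrow>
     feasible_mechanism n lo hi v a p \<and>
     (\<forall>a' p'. feasible_mechanism n lo hi v a' p' \<longrightarrow> revenue lo hi f p' \<le> revenue lo hi f p)"

definition optimal_menu ::
  "nat \<Rightarrow> real \<Rightarrow> real \<Rightarrow> (real \<Rightarrow> real) \<Rightarrow> (nat set \<Rightarrow> real \<Rightarrow> real) \<Rightarrow> nat set set \<Rightarrow> bool" where
  "optimal_menu n lo hi f v B \<longleftrightarrow>
     B \<subseteq> bundles n \<and>
     (\<exists>a p. optimal_mechanism n lo hi f v a p \<and> (\<forall>t\<in>{lo..hi}. a t \<in> return_pmf ` B))"

definition minimal_optimal_menu ::
  "nat \<Rightarrow> real \<Rightarrow> real \<Rightarrow> (real \<Rightarrow> real) \<Rightarrow> (nat set \<Rightarrow> real \<Rightarrow> real) \<Rightarrow> nat set set \<Rightarrow> bool" where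
  "minimal_optimal_menu n lo hi f v B \<longleftrightarrow>
     optimal_menu n lo hi f v B \<and> (\<forall>B'. B' \<subset> B \<longrightarrow> \<not> optimal_menu n lo hi f v B')"

definition nested_menu :: "nat set set \<Rightarrow> bool" where
  "nested_menu B \<longleftrightarrow> (\<forall>b\<in>B. \<forall>b'\<in>B. b \<subseteq> b' \<or> b' \<subseteq> b)"

end

theory Submission
  imports Defs
begin

text \<open>
  Let \<open>\<phi>\<close> be the virtual value. The envelope formula bounds the revenue of a feasible mechanism by its
  expected virtual surplus, hence by the integral of the pointwise maximum of \<open>\<phi>\<close>. A menu that
  attains this maximum everywhere \<^emph>\<open>covers\<close>. A nested minimal covering menu is implementable: the
  largest maximizer is increasing in the type, value differences along the chain are increasing,
  and so the envelope payments are incentive compatible. Hence optimal menus are exactly the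
  covering ones, provided that every minimal covering menu is nested.

  If \<open>b \<subseteq> u\<close> and \<open>Q b \<le> Q u\<close>, then single crossing of \<open>\<phi> u - \<phi> b\<close>, which is nonnegative both at the
  zero of \<open>\<phi> b\<close> and at the top type, gives \<open>\<phi> b \<le> max 0 (\<phi> u)\<close>. With the union quantity condition
  this shows that the cumulative unions cover. For two incomparable members of a minimal covering
  menu it shows that their union ties with one of them where that one is uniquely best in the menu.
  Such ties are excluded by (A2): all linear combinations of the \<open>\<phi> b\<close> are single-crossing, so one
  that vanishes at both end points vanishes, and the \<open>\<phi> b\<close> span a space of dimension at most two.
\<close>

section \<open>Integrals and one-sided increments\<close>

text \<open>A one-sided envelope theorem. Integrating the hypothesis over \<open>{a..t}\<close> telescopes the right-hand
  side into averages of \<open>U\<close> near \<open>t\<close> and near \<open>a\<close>, so no almost-everywhere differentiability of \<open>U\<close>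
  is needed.\<close>

lemma integral_le_increment:
  fixes U g :: "real \<Rightarrow> real"
  assumes ab: "a \<le> b"
    and U: "continuous_on {a..b} U"
    and g: "g integrable_on {a..b}"
    and incr: "\<And>e. 0 < e \<Longrightarrow> \<forall>\<^sub>F h in at_right 0. \<forall>s. a \<le> s \<longrightarrow> s + h \<le> b \<longrightarrow>
      h * (g s - e) \<le> U (s + h) - U s"
  shows "integral {a..b} g \<le> U b - U a"
proof -
  \<comment> \<open>Below \<open>b\<close> there is room for the window \<open>{t..t+h}\<close>; the
    end point is reached by continuity afterwards.\<close>
  have before: "integral {a..t} g \<le> U t - U a" if t: "a \<le> t" "t < b" for t
  proof (rule field_le_epsilon)
    fix e0 :: real assume e0: "0 < e0"
    \<comment> \<open>Error budget: \<open>e\<close> for each of the two averages near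
      \<open>t\<close> and \<open>a\<close>, and \<open>(t - a) * e\<close> for the slack integrated
      over \<open>{a..t}\<close>.\<close>
    define e where "e = e0 / (2 + (t - a))"
    have e: "0 < e" using e0 t by (simp add: e_def)
    have near: "\<forall>\<^sub>F h in at_right 0. \<forall>r\<in>{c..c+h}. \<bar>U r - U c\<bar> \<le> e" if c: "a \<le> c" "c < b" for c
    proof -
      have "\<exists>d>0. \<forall>r\<in>{a..b}. dist r c < d \<longrightarrow> dist (U r) (U c) < e"
        using U c e unfolding continuous_on_iff by auto
      then obtain d where d: "d > 0" "\<And>r. r \<in> {a..b} \<Longrightarrow> dist r c < d \<Longrightarrow> dist (U r) (U c) < e"
        by blast
      have "\<forall>r\<in>{c..c+h}. \<bar>U r - U c\<bar> \<le> e" if "0 < h" "h < min d (b - c)" for h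
      proof
        fix r assume "r \<in> {c..c+h}"
        then have "dist (U r) (U c) < e" using that c by (intro d(2)) (auto simp: dist_real_def)
        then show "\<bar>U r - U c\<bar> \<le> e" by (simp add: dist_real_def)
      qed
      then show ?thesis
        using d(1) c unfolding eventually_at_right_field
        by (intro exI[of _ "min d (b - c)"]) auto
    qed
    have small: "\<forall>\<^sub>F h in at_right 0. h < b - t"
      using t unfolding eventually_at_right_field by (intro exI[of _ "b - t"]) auto
    have "\<forall>\<^sub>F h in at_right (0::real). 0 < h \<and> h < b - t \<and>
        (\<forall>r\<in>{t..t+h}. \<bar>U r - U t\<bar> \<le> e) \<and> (\<forall>r\<in>{a..a+h}. \<bar>U r - U a\<bar> \<le> e) \<and>
        (\<forall>s. a \<le> s \<longrightarrow> s + h \<le> b \<longrightarrow> h * (g s - e) \<le> U (s + h) - U s)"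
      using incr[OF e] near[of t] near[of a] small t eventually_at_right_less[of "0::real"]
      by (auto intro!: eventually_conj)
    then obtain h where h: "0 < h" "h < b - t"
      and nt: "\<And>r. r\<in>{t..t+h} \<Longrightarrow> \<bar>U r - U t\<bar> \<le> e" and na: "\<And>r. r\<in>{a..a+h} \<Longrightarrow> \<bar>U r - U a\<bar> \<le> e"
      and ih: "\<And>s. a \<le> s \<Longrightarrow> s + h \<le> b \<Longrightarrow> h * (g s - e) \<le> U (s + h) - U s"
      using eventually_happens'[OF trivial_limit_at_right_real] by blast
    have Ui: "U integrable_on {c..d}" if "a \<le> c" "d \<le> b" for c d
      using that by (intro integrable_continuous_interval continuous_on_subset[OF U]) auto
    have gi: "g integrable_on {a..t}"
      using g t by (auto intro: integrable_subinterval_real)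
    have sh: "((\<lambda>s. U (s + h)) has_integral integral {a+h..t+h} U) {a..t}"
      using has_integral_shift_real_ivl[OF integrable_integral[OF Ui], of "a+h" "t+h" h] h t by simp
    have "integral {a..t} (\<lambda>s. h * (g s - e)) \<le> integral {a..t} (\<lambda>s. U (s + h) - U s)"
      using ih h t gi Ui[of a t] sh
      by (intro integral_le integrable_diff) (auto intro!: integrable_on_cmult_left integrable_diff
        simp: has_integral_integrable)
    also have "\<dots> = integral {a+h..t+h} U - integral {a..t} U"
      using integral_diff[OF has_integral_integrable[OF sh] Ui[of a t]] integral_unique[OF sh] t by simp
    \<comment> \<open>Splitting \<open>integral {a..t+h} U\<close> at \<open>t\<close> and at
      \<open>a+h\<close> gives this even when \<open>a+h\<close> lies beyond
      \<open>t\<close>.\<close>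
    also have "\<dots> = integral {t..t+h} U - integral {a..a+h} U"
      using Henstock_Kurzweil_Integration.integral_combine[of a t "t+h" U]
        Henstock_Kurzweil_Integration.integral_combine[of a "a+h" "t+h" U] Ui[of a "t+h"] h t by simp
    also have "\<dots> \<le> h * (U t + e) - h * (U a - e)"
    proof -
      have "integral {t..t+h} U \<le> integral {t..t+h} (\<lambda>_. U t + e)"
        using nt h t Ui by (intro integral_le) (fastforce simp: abs_le_iff)+
      moreover have "integral {a..a+h} (\<lambda>_. U a - e) \<le> integral {a..a+h} U"
        using na h t Ui by (intro integral_le) (fastforce simp: abs_le_iff)+
      ultimately show ?thesis using h by simp
    qed
    moreover have "integral {a..t} (\<lambda>s. h * (g s - e)) = h * (integral {a..t} g - (t - a) * e)"
      using integral_diff[OF gi integrable_const_ivl[of e]] t by simp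
    ultimately have "h * (integral {a..t} g - (t - a) * e) \<le> h * (U t - U a + 2 * e)"
      by (simp add: algebra_simps)
    then have "integral {a..t} g - (t - a) * e \<le> U t - U a + 2 * e"
      using h(1) by simp
    then have "integral {a..t} g \<le> U t - U a + (2 + (t - a)) * e"
      by (simp add: algebra_simps)
    then show "integral {a..t} g \<le> U t - U a + e0"
      using t by (simp add: e_def)
  qed
  show ?thesis
  proof (cases "a = b")
    case False
    have cont: "continuous_on {a..b} (\<lambda>t. U t - U a - integral {a..t} g)"
      by (intro continuous_intros U indefinite_integral_continuous_1 g)
    have "0 \<le> U b - U a - integral {a..b} g"
    proof (rule tendsto_lowerbound)
      show "((\<lambda>t. U t - U a - integral {a..t} g) \<longlongrightarrow> U b - U a - integral {a..b} g) (at b within {a..b})"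
        using cont ab by (simp add: continuous_on)
      show "\<forall>\<^sub>F t in at b within {a..b}. 0 \<le> U t - U a - integral {a..t} g"
        unfolding eventually_at_filter by (auto intro!: always_eventually before)
      show "at b within {a..b} \<noteq> bot"
        using False ab by (simp add: trivial_limit_within)
    qed
    then show ?thesis by simp
  qed (use ab in simp)
qed

text \<open>Uniform continuity of \<open>u'\<close> yields one step size for all \<open>s\<close> at
  once, which is the uniformity that \<open>integral_le_increment\<close> asks for.\<close>

lemma C1_increment_ge:
  fixes u u' :: "real \<Rightarrow> real"
  assumes der: "\<And>t. t \<in> {a..b} \<Longrightarrow> (u has_real_derivative u' t) (at t within {a..b})"
    and cont: "continuous_on {a..b} u'" and e: "0 < e"
  shows "\<forall>\<^sub>F h in at_right 0. \<forall>s. a \<le> s \<longrightarrow> s + h \<le> b \<longrightarrow> h * (u' s - e) \<le> u (s + h) - u s"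
proof -
  have "uniformly_continuous_on {a..b} u'"
    using cont by (intro compact_uniformly_continuous) auto
  then obtain d where d: "d > 0"
    "\<And>x y. x \<in> {a..b} \<Longrightarrow> y \<in> {a..b} \<Longrightarrow> dist y x < d \<Longrightarrow> dist (u' y) (u' x) < e"
    unfolding uniformly_continuous_on_def using e by metis
  have "h * (u' s - e) \<le> u (s + h) - u s" if h: "0 < h" "h < d" and s: "a \<le> s" "s + h \<le> b" for h s
  proof -
    have inc: "((\<lambda>r. u' r) has_integral u (s + h) - u s) {s..s+h}"
      using h s by (intro fundamental_theorem_of_calculus)
        (auto simp: has_real_derivative_iff_has_vector_derivative[symmetric]
          intro!: DERIV_subset[OF der])
    have "((\<lambda>_. u' s - e) has_integral h * (u' s - e)) {s..s+h}"
      using has_integral_const_real[of "u' s - e" s "s+h"] h by simp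
    then show ?thesis
    proof (rule has_integral_le[OF _ inc])
      fix r assume "r \<in> {s..s+h}"
      then have "dist (u' r) (u' s) < e" using h s by (intro d(2)) (auto simp: dist_real_def)
      then show "u' s - e \<le> u' r" by (simp add: dist_real_def)
    qed
  qed
  then show ?thesis
    using d(1) unfolding eventually_at_right_field by blast
qed

lemma set_integrable_bounded_measurable:
  fixes g :: "real \<Rightarrow> real"
  assumes "g \<in> borel_measurable (restrict_space borel {a..b})" "\<And>t. t \<in> {a..b} \<Longrightarrow> \<bar>g t\<bar> \<le> K"
  shows "set_integrable lborel {a..b} g"
proof -
  have "(\<lambda>x. indicator {a..b} x *\<^sub>R g x) \<in> borel_measurable borel"
    using assms(1) by (simp add: borel_measurable_restrict_space_iff)
  then show ?thesis unfolding set_integrable_def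
    by (intro integrableI_bounded_set[where A="{a..b}" and B=K])
      (auto simp: emeasure_lborel_Icc_eq assms(2))
qed

lemma set_integrable_continuous_mult:
  fixes g w :: "real \<Rightarrow> real"
  assumes w: "continuous_on {a..b} w" and g: "set_integrable lborel {a..b} g"
  shows "set_integrable lborel {a..b} (\<lambda>t. w t * g t)"
proof -
  have "bounded (w ` {a..b})"
    using w by (intro compact_imp_bounded compact_continuous_image) auto
  then obtain K where K: "\<And>t. t \<in> {a..b} \<Longrightarrow> \<bar>w t\<bar> \<le> K"
    unfolding bounded_iff by (metis imageI real_norm_def)
  have "(\<lambda>x. indicator {a..b} x *\<^sub>R w x) \<in> borel_measurable borel"
    by (rule borel_measurable_continuous_on_indicator) (use w in auto)
  moreover have "(\<lambda>x. indicator {a..b} x *\<^sub>R g x) \<in> borel_measurable borel"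
    using g unfolding set_integrable_def by auto
  ultimately have "(\<lambda>x. (indicator {a..b} x *\<^sub>R w x) * (indicator {a..b} x *\<^sub>R g x)) \<in> borel_measurable borel"
    by measurable
  moreover have "(\<lambda>x. (indicator {a..b} x *\<^sub>R w x) * (indicator {a..b} x *\<^sub>R g x)) =
      (\<lambda>x. indicator {a..b} x *\<^sub>R (w x * g x))"
    by (auto simp: indicator_def)
  ultimately have meas: "set_borel_measurable lborel {a..b} (\<lambda>t. w t * g t)"
    unfolding set_borel_measurable_def by simp
  show ?thesis
    by (rule set_integrable_bound[OF set_integrable_mult_right[of K, OF g] meas])
      (use K in \<open>auto simp: abs_mult intro!: AE_I2 mult_right_mono order_trans[OF K abs_ge_self]\<close>)
qed

text \<open>Fubini on the triangle \<open>s \<le> t\<close>: both sides integrate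
  \<open>w t * g s\<close> over it. This turns expected rents into marginal values weighted by the
  mass of higher types.\<close>

lemma integral_mult_indefinite_integral:
  fixes w g :: "real \<Rightarrow> real"
  assumes w: "set_integrable lborel {a..b} w" and g: "set_integrable lborel {a..b} g"
  shows "integral {a..b} (\<lambda>t. w t * integral {a..t} g) =
    integral {a..b} (\<lambda>s. integral {s..b} w * g s)"
proof -
  define W where "W = (\<lambda>t. indicator {a..b} t * w t)"
  define G where "G = (\<lambda>t. indicator {a..b} t * g t)"
  have W: "integrable lborel W" and G: "integrable lborel G"
    using w g by (auto simp: set_integrable_def W_def G_def)
  have Wm[measurable]: "W \<in> borel_measurable borel" and Gm[measurable]: "G \<in> borel_measurable borel"
    using W G by auto
  define k where "k = (\<lambda>s t. indicator {s..} t * (G s * W t))"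
  have km[measurable]: "case_prod k \<in> borel_measurable (lborel \<Otimes>\<^sub>M lborel)"
  proof -
    have "case_prod k = (\<lambda>x. if fst x \<le> snd x then G (fst x) * W (snd x) else 0)"
      by (auto simp: k_def indicator_def)
    then show ?thesis by simp
  qed
  have kW: "integrable lborel (\<lambda>t. k s t)" for s
    unfolding k_def by (intro integrable_mult_indicator[of _ _ "\<lambda>t. G s * W t", simplified]) (use W in auto)
  have "integrable (lborel \<Otimes>\<^sub>M lborel) (case_prod k)"
  proof (rule lborel_pair.Fubini_integrable)
    show "AE x in lborel. integrable lborel (\<lambda>y. case_prod k (x, y))" using kW by simp
    have "integrable lborel (\<lambda>x. \<bar>G x\<bar> * (LINT y|lborel. \<bar>W y\<bar>))" using G by auto
    then show "integrable lborel (\<lambda>x. LINT y|lborel. norm (case_prod k (x, y)))"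
    proof (rule Bochner_Integration.integrable_bound)
      show "AE x in lborel. norm (LINT y|lborel. norm (case_prod k (x, y)))
          \<le> norm (\<bar>G x\<bar> * (LINT y|lborel. \<bar>W y\<bar>))"
      proof (rule AE_I2)
        fix x
        have "(LINT y|lborel. norm (k x y)) \<le> (LINT y|lborel. \<bar>G x\<bar> * \<bar>W y\<bar>)"
          using W by (intro integral_mono integrable_norm kW) (auto simp: k_def indicator_def abs_mult)
        then show "norm (LINT y|lborel. norm (case_prod k (x, y)))
          \<le> norm (\<bar>G x\<bar> * (LINT y|lborel. \<bar>W y\<bar>))"
          by (simp add: abs_mult)
      qed
    qed (use km in measurable)
  qed (rule km)
  then have swap: "(LINT t|lborel. LINT s|lborel. k s t) = (LINT s|lborel. LINT t|lborel. k s t)"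
    by (rule lborel_pair.Fubini_integral)
  have inner: "(LINT s|lborel. k s t) = indicator {a..b} t * (w t * integral {a..t} g)" for t
  proof (cases "t \<in> {a..b}")
    case True
    have "(LINT s|lborel. k s t) = (LINT s|lborel. w t * (indicator {a..t} s *\<^sub>R g s))"
      using True by (intro Bochner_Integration.integral_cong) (auto simp: k_def W_def G_def indicator_def)
    also have "\<dots> = w t * (LINT s:{a..t}|lborel. g s)"
      by (simp add: set_lebesgue_integral_def)
    also have "(LINT s:{a..t}|lborel. g s) = integral {a..t} g"
      by (intro set_borel_integral_eq_integral set_integrable_subset[OF g]) (use True in auto)
    finally show ?thesis using True by simp
  qed (simp add: k_def W_def)
  have outer: "(LINT t|lborel. k s t) = indicator {a..b} s * (integral {s..b} w * g s)" for s
  proof (cases "s \<in> {a..b}")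
    case True
    have "(LINT t|lborel. k s t) = (LINT t|lborel. g s * (indicator {s..b} t *\<^sub>R w t))"
      using True by (intro Bochner_Integration.integral_cong) (auto simp: k_def W_def G_def indicator_def)
    also have "\<dots> = g s * (LINT t:{s..b}|lborel. w t)"
      by (simp add: set_lebesgue_integral_def)
    also have "(LINT t:{s..b}|lborel. w t) = integral {s..b} w"
      by (intro set_borel_integral_eq_integral set_integrable_subset[OF w]) (use True in auto)
    finally show ?thesis using True by simp
  qed (simp add: k_def G_def)
  have gH: "g integrable_on {a..b}" and wH: "w integrable_on {a..b}"
    using w g by (auto intro: set_borel_integral_eq_integral)
  have "set_integrable lborel {a..b} (\<lambda>t. integral {a..t} g * w t)"
    by (intro set_integrable_continuous_mult indefinite_integral_continuous_1 gH w)
  moreover have "set_integrable lborel {a..b} (\<lambda>s. integral {s..b} w * g s)"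
    by (intro set_integrable_continuous_mult indefinite_integral_continuous_1' wH g)
  ultimately show ?thesis
    using swap unfolding inner outer
    by (simp add: set_borel_integral_eq_integral(2)[symmetric] mult.commute set_lebesgue_integral_def)
qed

lemma nonneg_derivative_of_mono:
  fixes u :: "real \<Rightarrow> real"
  assumes "mono_on {a..b} u" "a < b" "t \<in> {a..b}" "(u has_real_derivative D) (at t within {a..b})"
  shows "0 \<le> D"
proof (rule tendsto_lowerbound)
  show "((\<lambda>y. (u y - u t) / (y - t)) \<longlongrightarrow> D) (at t within {a..b})"
    using assms(4) by (simp add: has_field_derivative_iff)
  show "at t within {a..b} \<noteq> bot"
    using assms(2,3) by (simp add: trivial_limit_within)
  show "\<forall>\<^sub>F y in at t within {a..b}. 0 \<le> (u y - u t) / (y - t)"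
    unfolding eventually_at_filter
  proof (intro always_eventually allI impI)
    fix y assume "y \<noteq> t" "y \<in> {a..b}"
    then show "0 \<le> (u y - u t) / (y - t)"
      using mono_onD[OF assms(1), of y t] mono_onD[OF assms(1), of t y] assms(3)
      by (cases "y < t") (auto simp: divide_simps)
  qed
qed

section \<open>Revenue and virtual surplus\<close>

lemma finite_bundles [simp]: "finite (bundles n)"
  by (simp add: bundles_def)

lemma empty_in_bundles [simp]: "{} \<in> bundles n"
  by (simp add: bundles_def)

lemma expected_eq_sum:
  assumes "a \<in> stochastic_bundles n"
  shows "expected g a t = (\<Sum>b\<in>bundles n. pmf a b * g b t)"
  using assms integral_measure_pmf_real[of "bundles n" a "\<lambda>b. g b t"]
  by (auto simp: expected_def stochastic_bundles_def mult.commute)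

lemma sum_pmf_stochastic_bundle:
  assumes "a \<in> stochastic_bundles n"
  shows "(\<Sum>b\<in>bundles n. pmf a b) = 1"
  using assms by (intro sum_pmf_eq_1) (auto simp: stochastic_bundles_def)

lemma expected_return_pmf [simp]: "expected g (return_pmf b) t = g b t"
  by (simp add: expected_def)

lemma continuous_on_Max_image:
  fixes g :: "'b \<Rightarrow> real \<Rightarrow> real"
  assumes "finite B" "B \<noteq> {}" "\<And>b. b \<in> B \<Longrightarrow> continuous_on T (g b)"
  shows "continuous_on T (\<lambda>t. Max ((\<lambda>b. g b t) ` B))"
  using assms
proof (induction B rule: finite_ne_induct)
  case (insert b B)
  then have "continuous_on T (\<lambda>t. max (g b t) (Max ((\<lambda>b. g b t) ` B)))"
    by (intro continuous_on_max) auto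
  then show ?case using insert by simp
qed simp

context bundling_environment
begin

abbreviation T :: "real set" where "T \<equiv> {lo..hi}"
abbreviation \<phi> :: "nat set \<Rightarrow> real \<Rightarrow> real" where "\<phi> \<equiv> virtual_value lo hi f v"
abbreviation F :: "real \<Rightarrow> real" where "F \<equiv> cdf (type_dist lo hi f)"
abbreviation dv :: "nat set \<Rightarrow> real \<Rightarrow> real" where "dv b \<equiv> type_deriv lo hi (v b)"

section \<open>The type distribution and the virtual value\<close>

lemma density_measurable:
  "(\<lambda>t. f t * indicator T t) \<in> borel_measurable borel"
  using borel_measurable_continuous_on_indicator[OF _ density_continuous] by (simp add: mult.commute)

lemma integrable_density: "set_integrable lborel T f"
  using density_continuous by (rule borel_integrable_atLeastAtMost')

lemma one_minus_cdf:
  assumes t: "t \<in> T"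
  shows "1 - F t = integral {t..hi} f"
proof -
  interpret prob_space "type_dist lo hi f" by (rule density_prob)
  have sp: "space (type_dist lo hi f) = UNIV" "sets (type_dist lo hi f) = sets borel"
    by (simp_all add: type_dist_def)
  have "UNIV - {..t} = {t<..}" by auto
  then have "1 - F t = measure (type_dist lo hi f) {t<..}"
    using prob_compl[of "{..t}"] by (simp add: cdf_def sp)
  also have "\<dots> = (LINT x|type_dist lo hi f. indicator {t<..} x)"
    by (simp add: sp)
  also have "\<dots> = (LINT x|lborel. (f x * indicator T x) *\<^sub>R indicator {t<..} x)"
    unfolding type_dist_def using density_pos density_measurable
    by (intro integral_density) (auto simp: indicator_def less_imp_le)
  also have "\<dots> = (LINT x:{t..hi}|lborel. f x)"
    unfolding set_lebesgue_integral_def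
  proof (rule integral_cong_AE)
    show "AE x in lborel. (f x * indicator T x) *\<^sub>R indicator {t<..} x = indicator {t..hi} x *\<^sub>R f x"
      using AE_lborel_singleton[of t] by eventually_elim (use t in \<open>auto simp: indicator_def\<close>)
    show "(\<lambda>x. (f x * indicator T x) *\<^sub>R (indicator {t<..} x :: real)) \<in> borel_measurable lborel"
      using borel_measurable_times[OF density_measurable borel_measurable_indicator[of "{t<..}" borel]]
      by simp
    have "set_integrable lborel {t..hi} f"
      by (rule set_integrable_subset[OF integrable_density]) (use t in auto)
    then show "(\<lambda>x. indicator {t..hi} x *\<^sub>R f x) \<in> borel_measurable lborel"
      unfolding set_integrable_def by auto
  qed
  also have "\<dots> = integral {t..hi} f"
    by (intro set_borel_integral_eq_integral set_integrable_subset[OF integrable_density]) (use t in auto)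
  finally show ?thesis .
qed

lemma cdf_hi [simp]: "F hi = 1"
  using one_minus_cdf[of hi] lo_less_hi by simp

lemma cdf_strict_mono:
  assumes "s \<in> T" "t \<in> T" "s < t"
  shows "F s < F t"
proof -
  have f: "continuous_on {c..d} f" if "lo \<le> c" "d \<le> hi" for c d
    using that by (intro continuous_on_subset[OF density_continuous]) auto
  have "integral {s..t} f \<noteq> 0"
    using integral_eq_0_iff[OF f[of s t]] assms density_pos by (force simp: less_imp_le)
  moreover have "0 \<le> integral {s..t} f"
    using f assms density_pos by (intro integral_nonneg) (auto intro: integrable_continuous_interval less_imp_le)
  moreover have "integral {s..t} f + integral {t..hi} f = integral {s..hi} f"
    using assms f by (intro Henstock_Kurzweil_Integration.integral_combine integrable_continuous_interval) auto
  ultimately show ?thesis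
    using one_minus_cdf[of s] one_minus_cdf[of t] assms by simp
qed

lemma cdf_le_iff:
  assumes "s \<in> T" "t \<in> T"
  shows "F s \<le> F t \<longleftrightarrow> s \<le> t"
  using cdf_strict_mono[of s t] cdf_strict_mono[of t s] assms by (cases s t rule: linorder_cases) auto

lemma cdf_continuous: "continuous_on T F"
proof -
  have "continuous_on T (\<lambda>t. 1 - integral {t..hi} f)"
    using density_continuous
    by (intro continuous_intros indefinite_integral_continuous_1' integrable_continuous_interval)
  then show ?thesis
    using one_minus_cdf by (subst continuous_on_cong[OF refl, of _ _ "\<lambda>t. 1 - integral {t..hi} f"]) force+
qed

lemma hazard_nonneg:
  assumes "t \<in> T"
  shows "0 \<le> (1 - F t) / f t"
  using cdf_le_iff[of t hi] assms density_pos lo_less_hi by (auto intro!: divide_nonneg_pos)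

lemma value_has_derivative:
  assumes "b \<in> bundles n" "t \<in> T"
  shows "(v b has_real_derivative dv b t) (at t within T)"
  using assms value_differentiable
  by (auto simp: differentiable_on_def vector_derivative_works type_deriv_def
    has_real_derivative_iff_has_vector_derivative)

lemma value_continuous: "b \<in> bundles n \<Longrightarrow> continuous_on T (v b)"
  using value_differentiable differentiable_imp_continuous_on by blast

lemma deriv_continuous: "b \<in> bundles n \<Longrightarrow> continuous_on T (dv b)"
  using value_C1 by blast

lemma virtual_value_continuous: "b \<in> bundles n \<Longrightarrow> continuous_on T (\<phi> b)"
  unfolding virtual_value_def using density_pos
  by (intro continuous_intros value_continuous deriv_continuous cdf_continuous density_continuous) force+

lemma deriv_eqI:
  assumes "t \<in> T" "(u has_real_derivative D) (at t within T)"
  shows "type_deriv lo hi u t = D"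
  unfolding type_deriv_def
  using assms lo_less_hi
  by (intro vector_derivative_within_closed_interval)
    (auto simp: has_real_derivative_iff_has_vector_derivative)

lemma deriv_diff_nonneg:
  assumes "b \<in> bundles n" "c \<in> bundles n" "t \<in> T" "mono_on T (\<lambda>t. v c t - v b t)"
  shows "dv b t \<le> dv c t"
proof -
  have "((\<lambda>t. v c t - v b t) has_real_derivative dv c t - dv b t) (at t within T)"
    using assms by (intro DERIV_diff value_has_derivative)
  from nonneg_derivative_of_mono[OF assms(4) lo_less_hi assms(3) this] show ?thesis by simp
qed

lemma virtual_value_empty [simp]:
  assumes "t \<in> T"
  shows "\<phi> {} t = 0"
proof -
  have "((\<lambda>_. 0) has_real_derivative 0) (at t within T)" by simp
  then have "(v {} has_real_derivative 0) (at t within T)"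
    by (rule has_field_derivative_transform_within[OF _ zero_less_one]) (use value_empty assms in auto)
  then show ?thesis
    using deriv_eqI[OF assms] value_empty assms by (simp add: virtual_value_def)
qed

lemma virtual_value_hi [simp]: "\<phi> b hi = v b hi"
  by (simp add: virtual_value_def)

text \<open>The conditions of \<open>mechanism\<close> that involve no payment, so that envelope
  identities can be stated before a payment is chosen.\<close>

definition allocation :: "(real \<Rightarrow> nat set pmf) \<Rightarrow> bool" where
  "allocation a \<longleftrightarrow> (\<forall>t\<in>T. a t \<in> stochastic_bundles n) \<and>
     (\<forall>b\<in>bundles n. (\<lambda>t. pmf (a t) b) \<in> borel_measurable (restrict_space borel T))"

lemma expected_allocation_integrable:
  assumes a: "allocation a" and h: "\<And>b. b \<in> bundles n \<Longrightarrow> continuous_on T (h b)"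
  shows "set_integrable lborel T (\<lambda>t. expected h (a t) t)"
proof -
  have "set_integrable lborel T (\<lambda>t. \<Sum>b\<in>bundles n. h b t * pmf (a t) b)"
    unfolding set_integrable_def scaleR_sum_right
  proof (rule Bochner_Integration.integrable_sum)
    fix b assume b: "b \<in> bundles n"
    have "set_integrable lborel T (\<lambda>t. pmf (a t) b)"
      using a b by (intro set_integrable_bounded_measurable[where K=1])
        (auto simp: allocation_def pmf_le_1)
    then have "set_integrable lborel T (\<lambda>t. h b t * pmf (a t) b)"
      by (rule set_integrable_continuous_mult[OF h[OF b]])
    then show "integrable lborel (\<lambda>t. indicator T t *\<^sub>R (h b t * pmf (a t) b))"
      by (simp add: set_integrable_def)
  qed
  then show ?thesis
    by (rule set_integrable_cong[THEN iffD1, rotated -1])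
      (use a in \<open>auto simp: allocation_def expected_eq_sum[where n=n] mult.commute\<close>)
qed

text \<open>The envelope formula for the utility of type \<open>t\<close>, normalised to zero at
  \<open>lo\<close>.\<close>

definition rent :: "(real \<Rightarrow> nat set pmf) \<Rightarrow> real \<Rightarrow> real" where
  "rent a t = integral {lo..t} (\<lambda>s. expected dv (a s) s)"

lemma marginal_rent_integrable:
  assumes "allocation a"
  shows "set_integrable lborel T (\<lambda>s. expected dv (a s) s)"
  using assms deriv_continuous by (rule expected_allocation_integrable)

lemma rent_continuous:
  assumes "allocation a"
  shows "continuous_on T (rent a)"
  unfolding rent_def
  by (intro indefinite_integral_continuous_1 set_borel_integral_eq_integral marginal_rent_integrable assms)

lemma expected_virtual_value:
  assumes "a \<in> stochastic_bundles n" "t \<in> T"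
  shows "f t * expected \<phi> a t = f t * expected v a t - (1 - F t) * expected dv a t"
proof -
  have "expected \<phi> a t = expected v a t - (1 - F t) / f t * expected dv a t"
    unfolding expected_eq_sum[OF assms(1)] virtual_value_def
    by (simp add: algebra_simps sum_subtractf sum_distrib_left)
  then show ?thesis using density_pos assms(2) by (force simp: field_simps)
qed

text \<open>Exchanging the order of integration in the expected rent weights the marginal value at
  \<open>s\<close> by \<open>1 - F s\<close>, which is the correction term in \<open>\<phi>\<close>
  once multiplied by the density.\<close>

lemma integral_virtual_surplus:
  assumes a: "allocation a"
  shows "integral T (\<lambda>t. f t * (expected v (a t) t - rent a t)) = integral T (\<lambda>t. f t * expected \<phi> (a t) t)"
proof -
  let ?g = "\<lambda>s. expected dv (a s) s"
  have fv: "set_integrable lborel T (\<lambda>t. f t * expected v (a t) t)"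
    using a value_continuous density_continuous
    by (intro set_integrable_continuous_mult expected_allocation_integrable)
  have fr: "(\<lambda>t. f t * rent a t) integrable_on T"
    by (intro integrable_continuous_interval continuous_intros density_continuous rent_continuous a)
  have sg: "set_integrable lborel T (\<lambda>t. (1 - F t) * ?g t)"
    using a by (intro set_integrable_continuous_mult marginal_rent_integrable continuous_intros cdf_continuous)
  have "integral T (\<lambda>t. f t * (expected v (a t) t - rent a t)) =
      integral T (\<lambda>t. f t * expected v (a t) t) - integral T (\<lambda>t. f t * rent a t)"
    unfolding right_diff_distrib by (intro integral_diff fr set_borel_integral_eq_integral fv)
  also have "integral T (\<lambda>t. f t * rent a t) = integral T (\<lambda>s. integral {s..hi} f * ?g s)"
    unfolding rent_def by (intro integral_mult_indefinite_integral integrable_density marginal_rent_integrable a)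
  also have "\<dots> = integral T (\<lambda>s. (1 - F s) * ?g s)"
    by (rule Henstock_Kurzweil_Integration.integral_cong) (simp add: one_minus_cdf)
  also have "integral T (\<lambda>t. f t * expected v (a t) t) - \<dots> =
      integral T (\<lambda>t. f t * expected v (a t) t - (1 - F t) * ?g t)"
    by (intro integral_diff[symmetric] set_borel_integral_eq_integral fv sg)
  also have "\<dots> = integral T (\<lambda>t. f t * expected \<phi> (a t) t)"
    using a by (intro Henstock_Kurzweil_Integration.integral_cong expected_virtual_value[symmetric])
      (auto simp: allocation_def)
  finally show ?thesis .
qed

lemma revenue_eq_integral:
  assumes "set_integrable lborel T p"
  shows "revenue lo hi f p = integral T (\<lambda>t. f t * p t)"
proof -
  have fp: "set_integrable lborel T (\<lambda>t. f t * p t)"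
    using density_continuous assms by (rule set_integrable_continuous_mult)
  have "(\<lambda>t. indicator T t *\<^sub>R p t) \<in> borel_measurable lborel"
    using assms by (auto simp: set_integrable_def)
  then have "revenue lo hi f p = (LINT t|lborel. (f t * indicator T t) *\<^sub>R (indicator T t *\<^sub>R p t))"
    unfolding revenue_def set_lebesgue_integral_def type_dist_def
    using density_pos density_measurable by (intro integral_density) (auto simp: indicator_def less_imp_le)
  also have "\<dots> = (LINT t:T|lborel. f t * p t)"
    unfolding set_lebesgue_integral_def
    by (intro Bochner_Integration.integral_cong) (auto simp: indicator_def)
  also have "\<dots> = integral T (\<lambda>t. f t * p t)"
    using fp by (rule set_borel_integral_eq_integral)
  finally show ?thesis .
qed

section \<open>Revenue bound for feasible mechanisms\<close>

context
  fixes a p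
  assumes feasible: "feasible_mechanism n lo hi v a p"
begin

lemma feasible_allocation: "allocation a"
  using feasible by (auto simp: feasible_mechanism_def mechanism_def allocation_def)

lemma feasible_stochastic: "t \<in> T \<Longrightarrow> a t \<in> stochastic_bundles n"
  using feasible_allocation by (simp add: allocation_def)

definition utility :: "real \<Rightarrow> real" where
  "utility t = expected v (a t) t - p t"

text \<open>Type \<open>t\<close> can imitate type \<open>s\<close>; the payment \<open>p s\<close>
  is the same for both and cancels, leaving only the value differences of the bundles.\<close>

lemma utility_diff_ge:
  assumes "s \<in> T" "t \<in> T"
  shows "(\<Sum>b\<in>bundles n. pmf (a s) b * (v b t - v b s)) \<le> utility t - utility s"
proof -
  have "expected v (a s) t - p s \<le> utility t"
    using feasible assms by (auto simp: feasible_mechanism_def incentive_compatible_def utility_def)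
  then show ?thesis
    using feasible_stochastic[OF assms(1)]
    by (simp add: utility_def expected_eq_sum algebra_simps sum_subtractf)
qed

text \<open>Imitation in both directions bounds the change of utility by the total change of all
  bundle values, because probabilities lie in the unit interval.\<close>

lemma utility_continuous: "continuous_on T utility"
  unfolding continuous_on_def
proof
  fix t assume t: "t \<in> T"
  let ?D = "\<lambda>s. \<Sum>b\<in>bundles n. \<bar>v b t - v b s\<bar>"
  have "continuous_on T ?D"
    by (intro continuous_intros value_continuous)
  then have D: "(?D \<longlongrightarrow> 0) (at t within T)"
    using t unfolding continuous_on_def by fastforce
  have *: "x - ?D s \<le> x + (\<Sum>b\<in>bundles n. q b * (v b t - v b s))"
    "x - ?D s \<le> x + (\<Sum>b\<in>bundles n. q b * (v b s - v b t))" if "\<And>b. 0 \<le> q b \<and> q b \<le> 1" for q x s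
  proof -
    have "- (y * z) \<le> \<bar>z\<bar> \<and> y * z \<le> \<bar>z\<bar>" if "0 \<le> y" "y \<le> 1" for y z :: real
    proof -
      have "\<bar>y * z\<bar> \<le> \<bar>z\<bar>" using that mult_right_mono[of y 1 "\<bar>z\<bar>"] by (simp add: abs_mult)
      then show ?thesis by linarith
    qed
    note y = this
    have "- \<bar>v b t - v b s\<bar> \<le> q b * (v b t - v b s)" "- \<bar>v b t - v b s\<bar> \<le> q b * (v b s - v b t)" for b
      using y[of "q b" "v b t - v b s"] y[of "q b" "v b s - v b t"] that[of b] by linarith+
    then show "x - ?D s \<le> x + (\<Sum>b\<in>bundles n. q b * (v b t - v b s))"
      "x - ?D s \<le> x + (\<Sum>b\<in>bundles n. q b * (v b s - v b t))"
      using sum_mono[of "bundles n" "\<lambda>b. - \<bar>v b t - v b s\<bar>"] by (simp_all add: sum_negf)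
  qed
  have "\<bar>utility s - utility t\<bar> \<le> ?D s" if s: "s \<in> T" for s
    using utility_diff_ge[OF s t] utility_diff_ge[OF t s] *(1)[of "pmf (a s)" 0 s] *(2)[of "pmf (a t)" 0 s]
    by (simp add: pmf_le_1)
  then have "\<forall>\<^sub>F s in at t within T. norm (utility s - utility t) \<le> ?D s"
    unfolding eventually_at_filter by (auto intro!: always_eventually)
  then have "((\<lambda>s. utility s - utility t) \<longlongrightarrow> 0) (at t within T)"
    by (rule Lim_null_comparison) (rule D)
  then show "(utility \<longlongrightarrow> utility t) (at t within T)"
    using LIM_zero_cancel by blast
qed

text \<open>Imitation bounds utility increments from below by value increments, hence to first order
  by \<open>expected dv\<close>, and \<open>integral_le_increment\<close> sums these up. Individual
  rationality at \<open>lo\<close> supplies the starting value.\<close>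

lemma rent_le_utility:
  assumes t: "t \<in> T"
  shows "rent a t \<le> utility t"
proof -
  have "rent a t \<le> utility t - utility lo"
    unfolding rent_def
  proof (rule integral_le_increment)
    show "lo \<le> t" using t by simp
    show "continuous_on {lo..t} utility"
      by (rule continuous_on_subset[OF utility_continuous]) (use t in auto)
    show "(\<lambda>s. expected dv (a s) s) integrable_on {lo..t}"
      by (intro set_borel_integral_eq_integral set_integrable_subset[OF marginal_rent_integrable]
          feasible_allocation) (use t in auto)
    fix e :: real assume e: "0 < e"
    have "\<forall>\<^sub>F h in at_right 0. \<forall>b\<in>bundles n. \<forall>s. lo \<le> s \<longrightarrow> s + h \<le> hi \<longrightarrow>
        h * (dv b s - e) \<le> v b (s + h) - v b s"
      by (intro eventually_ball_finite finite_bundles ballI C1_increment_ge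
          value_has_derivative deriv_continuous e)
    then show "\<forall>\<^sub>F h in at_right 0. \<forall>s. lo \<le> s \<longrightarrow> s + h \<le> t \<longrightarrow>
        h * (expected dv (a s) s - e) \<le> utility (s + h) - utility s"
      using eventually_at_right_less[of "0::real"]
    proof eventually_elim
      case (elim h)
      show ?case
      proof (intro allI impI)
        fix s assume s: "lo \<le> s" "s + h \<le> t"
        then have sT: "s \<in> T" "s + h \<in> T" using t elim by auto
        \<comment> \<open>The probabilities sum to one, so the slack \<open>e\<close> can be spread
          over the bundles.\<close>
        have "h * (expected dv (a s) s - e) = h * ((\<Sum>b\<in>bundles n. pmf (a s) b * dv b s) - (\<Sum>b\<in>bundles n. pmf (a s) b) * e)"
          using feasible_stochastic[OF sT(1)] by (simp add: expected_eq_sum sum_pmf_stochastic_bundle)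
        also have "\<dots> = (\<Sum>b\<in>bundles n. pmf (a s) b * (h * (dv b s - e)))"
          by (simp add: sum_distrib_left sum_distrib_right sum_subtractf algebra_simps)
        also have "\<dots> \<le> (\<Sum>b\<in>bundles n. pmf (a s) b * (v b (s + h) - v b s))"
          using elim s t by (intro sum_mono mult_left_mono) auto
        also have "\<dots> \<le> utility (s + h) - utility s"
          by (rule utility_diff_ge) (use sT in auto)
        finally show "h * (expected dv (a s) s - e) \<le> utility (s + h) - utility s" .
      qed
    qed
  qed
  moreover have "0 \<le> utility lo"
    using feasible lo_less_hi by (auto simp: feasible_mechanism_def individually_rational_def utility_def)
  ultimately show ?thesis by simp
qed

lemma feasible_revenue_le: "revenue lo hi f p \<le> integral T (\<lambda>t. f t * expected \<phi> (a t) t)"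
proof -
  let ?V = "\<lambda>t. expected v (a t) t"
  have V: "set_integrable lborel T ?V"
    using feasible_allocation value_continuous by (rule expected_allocation_integrable)
  have int: "set_integrable lborel T (\<lambda>t. ?V t - u t)" if "continuous_on T u" for u
    using that by (intro set_integral_diff V borel_integrable_atLeastAtMost')
  have "set_integrable lborel T p"
    using int[OF utility_continuous] by (simp add: utility_def)
  then have "revenue lo hi f p = integral T (\<lambda>t. f t * (?V t - utility t))"
    by (simp add: revenue_eq_integral utility_def)
  also have "\<dots> \<le> integral T (\<lambda>t. f t * (?V t - rent a t))"
    using rent_le_utility density_pos
    by (intro integral_le set_borel_integral_eq_integral set_integrable_continuous_mult int
        density_continuous utility_continuous rent_continuous feasible_allocation)
      (simp add: less_imp_le)
  also have "\<dots> = integral T (\<lambda>t. f t * expected \<phi> (a t) t)"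
    by (rule integral_virtual_surplus[OF feasible_allocation])
  finally show ?thesis .
qed

end

definition menu_surplus :: "nat set set \<Rightarrow> real \<Rightarrow> real" where
  "menu_surplus B t = Max ((\<lambda>b. \<phi> b t) ` B)"

lemma menu_surplus_continuous:
  assumes "B \<subseteq> bundles n" "B \<noteq> {}"
  shows "continuous_on T (menu_surplus B)"
  unfolding menu_surplus_def using assms
  by (intro continuous_on_Max_image virtual_value_continuous) (auto intro: finite_subset)

lemma expected_le_menu_surplus:
  assumes "B \<subseteq> bundles n" "set_pmf a \<subseteq> B"
  shows "expected \<phi> a t \<le> menu_surplus B t"
proof -
  have B: "finite B" using assms by (auto intro: finite_subset)
  have "expected \<phi> a t = (\<Sum>b\<in>B. \<phi> b t * pmf a b)"
    unfolding expected_def using assms B by (intro integral_measure_pmf_real) auto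
  also have "\<dots> \<le> (\<Sum>b\<in>B. menu_surplus B t * pmf a b)"
    using B by (intro sum_mono mult_right_mono) (auto simp: menu_surplus_def)
  also have "\<dots> = menu_surplus B t"
    using assms B by (simp add: sum_distrib_left[symmetric] sum_pmf_eq_1)
  finally show ?thesis .
qed

text \<open>Used twice: with all bundles it is the benchmark for optimality, and with an optimal
  menu it forces that menu to reach the benchmark.\<close>

lemma feasible_revenue_le_menu_surplus:
  assumes feas: "feasible_mechanism n lo hi v a p" and B: "B \<subseteq> bundles n"
    and a: "\<And>t. t \<in> T \<Longrightarrow> set_pmf (a t) \<subseteq> B"
  shows "revenue lo hi f p \<le> integral T (\<lambda>t. f t * menu_surplus B t)"
proof -
  have "B \<noteq> {}" using a[of lo] lo_less_hi set_pmf_not_empty[of "a lo"] by auto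
  then have "continuous_on T (\<lambda>t. f t * menu_surplus B t)"
    by (intro continuous_intros density_continuous menu_surplus_continuous B)
  then have "integral T (\<lambda>t. f t * expected \<phi> (a t) t) \<le> integral T (\<lambda>t. f t * menu_surplus B t)"
    using a B density_pos
    by (intro integral_le integrable_continuous_interval set_borel_integral_eq_integral
        set_integrable_continuous_mult density_continuous expected_allocation_integrable
        feasible_allocation[OF feas] virtual_value_continuous mult_left_mono expected_le_menu_surplus)
      (auto simp: less_imp_le)
  then show ?thesis using feasible_revenue_le[OF feas] by simp
qed

end

section \<open>Menus attaining the maximal virtual surplus\<close>

lemma sgn_mono_nonneg:
  fixes g :: "real \<Rightarrow> real"
  assumes "mono_on S (\<lambda>t. sgn (g t))" "s \<in> S" "t \<in> S" "s \<le> t" "0 \<le> g s"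
  shows "0 \<le> g t"
  using mono_onD[OF assms(1-4)] assms(5) by (auto simp: sgn_if split: if_splits)

lemma sgn_mono_pos:
  fixes g :: "real \<Rightarrow> real"
  assumes "mono_on S (\<lambda>t. sgn (g t))" "s \<in> S" "t \<in> S" "s \<le> t" "0 < g s"
  shows "0 < g t"
  using mono_onD[OF assms(1-4)] assms(5) by (auto simp: sgn_if split: if_splits)

lemma single_crossing_on_cases:
  assumes "single_crossing_on S g"
  obtains "mono_on S (\<lambda>t. sgn (g t))" | "mono_on S (\<lambda>t. sgn (- g t))"
  using assms by (auto simp: single_crossing_on_def monotonic_on_def sgn_minus monotone_on_def)

text \<open>In the decreasing case \<open>- g\<close> would stay positive from \<open>s\<close>
  on.\<close>

lemma single_crossing_on_upward:
  assumes "single_crossing_on S g" "s \<in> S" "t \<in> S" "s \<le> t" "g s < 0" "0 \<le> g t"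
  shows "mono_on S (\<lambda>t. sgn (g t))"
  using assms(1)
proof (cases rule: single_crossing_on_cases)
  case 2
  then show ?thesis using sgn_mono_pos[OF 2 assms(2-4)] assms(5,6) by simp
qed

lemma single_crossing_on_zero_between:
  assumes sc: "single_crossing_on S g" and "r \<in> S" "s \<in> S" "t \<in> S" "r \<le> s" "s \<le> t"
    and "g r = 0" "g t = 0"
  shows "g s = 0"
  using sc
proof (cases rule: single_crossing_on_cases)
  case 1
  show ?thesis
    using mono_onD[OF 1, of r s] mono_onD[OF 1, of s t] assms by (auto simp: sgn_if split: if_splits)
next
  case 2
  show ?thesis
    using mono_onD[OF 2, of r s] mono_onD[OF 2, of s t] assms by (auto simp: sgn_if split: if_splits)
qed

lemma Union_in_finite_chain:
  assumes "finite S" "S \<noteq> {}" "\<And>x y. x \<in> S \<Longrightarrow> y \<in> S \<Longrightarrow> x \<subseteq> y \<or> y \<subseteq> x"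
  shows "\<Union>S \<in> S"
  using assms
proof (induction S rule: finite_ne_induct)
  case (insert x S)
  then have "\<Union>S \<in> S" by auto
  then have "x \<subseteq> \<Union>S \<or> \<Union>S \<subseteq> x" using insert.prems by simp
  then show ?case using \<open>\<Union>S \<in> S\<close> by (auto simp: Un_absorb1 Un_absorb2)
qed simp

lemma pmf_of_weights:
  fixes q :: "'a \<Rightarrow> real"
  assumes "finite B" "\<And>b. b \<in> B \<Longrightarrow> 0 \<le> q b" "(\<Sum>b\<in>B. q b) = 1"
  obtains a where "set_pmf a \<subseteq> B" "\<And>b. b \<in> B \<Longrightarrow> pmf a b = q b"
proof -
  define w where "w = (\<lambda>b. if b \<in> B then q b else 0)"
  have w: "0 \<le> w b" for b using assms by (simp add: w_def)
  have "(\<integral>\<^sup>+ b. ennreal (w b) \<partial>count_space UNIV) = (\<Sum>b\<in>B. ennreal (w b))"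
    using assms(1) by (intro nn_integral_count_space'[where A=B]) (auto simp: w_def)
  also have "\<dots> = 1"
    using assms by (simp add: w_def)
  finally have p: "pmf (embed_pmf w) b = w b" for b
    using w by (intro pmf_embed_pmf)
  show thesis
  proof (rule that[of "embed_pmf w"])
    show "set_pmf (embed_pmf w) \<subseteq> B"
      unfolding subset_iff set_pmf_iff p by (simp add: w_def)
    show "pmf (embed_pmf w) b = q b" if "b \<in> B" for b
      unfolding p using that by (simp add: w_def)
  qed
qed

text \<open>The hypothesis holds for any three members of a linear space of functions on which
  evaluation at \<open>lo\<close> and \<open>hi\<close> is injective. The proof applies it to the coefficients of the
  3-by-3 determinant with rows \<open>lo\<close>, \<open>hi\<close>, \<open>t\<close>.\<close>

lemma proportional_at_zeros:
  fixes g h k :: "real \<Rightarrow> real"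
  assumes vanish: "\<And>x y z t. t \<in> S \<Longrightarrow> x * g lo + y * h lo + z * k lo = 0 \<Longrightarrow>
      x * g hi + y * h hi + z * k hi = 0 \<Longrightarrow> x * g t + y * h t + z * k t = 0"
    and u: "u \<in> S" "g u \<noteq> 0" and s: "s \<in> S" "g s = 0" and r: "r \<in> S" "g r = 0"
  shows "h s * k r = h r * k s"
proof -
  define P where "P = g lo * k hi - g hi * k lo"
  define Q where "Q = g lo * h hi - g hi * h lo"
  define D where "D = h lo * k hi - h hi * k lo"
  have g: "g lo \<noteq> 0 \<or> g hi \<noteq> 0" using vanish[OF u(1), of 1 0 0] u(2) by auto
  show ?thesis
  proof (cases "P = 0")
    case True
    \<comment> \<open>\<open>P = 0\<close> makes the end-point values of \<open>g\<close> and
      \<open>k\<close> linearly dependent, so that \<open>k\<close> vanishes wherever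
      \<open>g\<close> does.\<close>
    have "k t = 0" if t: "t \<in> S" "g t = 0" for t
      using vanish[OF t(1), of "- k lo" 0 "g lo"] vanish[OF t(1), of "- k hi" 0 "g hi"] True g t(2)
      by (auto simp: P_def algebra_simps)
    then show ?thesis using s r by simp
  next
    case False
    have "D * g t - P * h t + Q * k t = 0" if "t \<in> S" for t
      using vanish[OF that, of D "- P" Q] by (simp add: P_def Q_def D_def algebra_simps)
    \<comment> \<open>At a zero of \<open>g\<close> the determinant identity ties \<open>h\<close>
      to \<open>k\<close> by the same factor \<open>Q / P\<close>.\<close>
    then have "P * h s = Q * k s" "P * h r = Q * k r" using s r by force+
    then have "P * (h s * k r) = P * (h r * k s)" by (metis mult.assoc mult.commute)
    then show ?thesis using False by simp
  qed
qed

locale single_crossing_environment = bundling_environment +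
  assumes bundle_single_crossing: "\<And>b c. b \<in> bundles n \<Longrightarrow> c \<in> bundles n \<Longrightarrow>
      single_crossing_on T (\<lambda>t. \<phi> b t - \<phi> c t)"
    and value_diff_monotonic: "\<And>b c. b \<in> bundles n \<Longrightarrow> c \<in> bundles n \<Longrightarrow>
      monotonic_on T (\<lambda>t. v b t - v c t)"
    and stochastic_single_crossing: "\<And>a c. a \<in> stochastic_bundles n \<Longrightarrow> c \<in> stochastic_bundles n \<Longrightarrow>
      single_crossing_on T (\<lambda>t. expected \<phi> a t - expected \<phi> c t)"
    and value_hi_mono: "\<And>b c. b \<in> bundles n \<Longrightarrow> c \<in> bundles n \<Longrightarrow> b \<subseteq> c \<Longrightarrow> v b hi \<le> v c hi"
begin

lemma lo_in_T: "lo \<in> T" and hi_in_T: "hi \<in> T"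
  using lo_less_hi by auto

text \<open>Compared with \<open>{}\<close>, a nonempty bundle is negative at \<open>lo\<close> and
  positive at \<open>hi\<close>, so only the increasing direction of single crossing is
  possible.\<close>

lemma virtual_value_upward:
  assumes "b \<in> bundles n" "b \<noteq> {}"
  shows "mono_on T (\<lambda>t. sgn (\<phi> b t))"
proof -
  have "\<phi> b lo < 0" "0 < \<phi> b hi" using assms virtual_value_lo_neg value_hi_pos by auto
  then have "mono_on T (\<lambda>t. sgn (\<phi> b t - \<phi> {} t))"
    using assms lo_less_hi lo_in_T hi_in_T
    by (intro single_crossing_on_upward[OF bundle_single_crossing, of _ _ lo hi])
      (simp_all del: virtual_value_hi)
  then show ?thesis by (auto simp: monotone_on_def)
qed

section \<open>Covering menus and minimal covers\<close>

definition covers :: "nat set set \<Rightarrow> bool" where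
  "covers B \<longleftrightarrow> (\<forall>t\<in>T. \<forall>b\<in>bundles n. \<exists>c\<in>B. \<phi> b t \<le> \<phi> c t)"

text \<open>By \<open>covers_mono\<close>, removing members one at a time tests all proper
  submenus.\<close>

definition minimal_cover :: "nat set set \<Rightarrow> bool" where
  "minimal_cover B \<longleftrightarrow> B \<subseteq> bundles n \<and> covers B \<and> (\<forall>c\<in>B. \<not> covers (B - {c}))"

lemma covers_mono: "covers C \<Longrightarrow> C \<subseteq> D \<Longrightarrow> covers D"
  unfolding covers_def by (meson subsetD)

text \<open>At \<open>lo\<close> only the empty bundle has a nonnegative virtual value.\<close>

lemma empty_in_cover:
  assumes "B \<subseteq> bundles n" "covers B"
  shows "{} \<in> B"
proof -
  obtain c where "c \<in> B" "0 \<le> \<phi> c lo"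
    using assms lo_in_T virtual_value_empty[OF lo_in_T] unfolding covers_def by (metis empty_in_bundles)
  then show ?thesis using assms virtual_value_lo_neg by force
qed

text \<open>Where the menu without \<open>c\<close> fails to cover, some bundle \<open>b\<close>
  beats all the other members; the member of \<open>B\<close> that covers \<open>b\<close> there can
  only be \<open>c\<close>.\<close>

lemma minimal_cover_best:
  assumes "minimal_cover B" "c \<in> B"
  obtains t where "t \<in> T" "\<And>d. d \<in> B \<Longrightarrow> d \<noteq> c \<Longrightarrow> \<phi> d t < \<phi> c t"
proof -
  obtain t b where t: "t \<in> T" "b \<in> bundles n" "\<And>d. d \<in> B \<Longrightarrow> d \<noteq> c \<Longrightarrow> \<phi> d t < \<phi> b t"
    using assms unfolding minimal_cover_def covers_def by (auto simp: not_le)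
  obtain e where "e \<in> B" "\<phi> b t \<le> \<phi> e t"
    using assms t(1,2) unfolding minimal_cover_def covers_def by blast
  then have "\<phi> b t \<le> \<phi> c t" using t(3)[of e] by (cases "e = c") auto
  then show thesis using t that by force
qed

lemma cover_contains_minimal_cover:
  assumes "B \<subseteq> bundles n" "covers B"
  obtains C where "C \<subseteq> B" "minimal_cover C"
proof -
  have "finite {C. C \<subseteq> B \<and> covers C}"
    using assms finite_subset[OF assms(1)] by auto
  moreover have "B \<in> {C. C \<subseteq> B \<and> covers C}" using assms by simp
  ultimately obtain C where C: "C \<subseteq> B" "covers C" "\<And>D. D \<subseteq> B \<Longrightarrow> covers D \<Longrightarrow> D \<subseteq> C \<Longrightarrow> C = D"
    using finite_has_minimal2[of "{C. C \<subseteq> B \<and> covers C}" B] by auto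
  have "\<not> covers (C - {c})" if "c \<in> C" for c
    using C(3)[of "C - {c}"] C(1) that by auto
  then show thesis using that C assms by (auto simp: minimal_cover_def)
qed

lemma menu_surplus_cover:
  assumes "B \<subseteq> bundles n" "covers B" "t \<in> T"
  shows "menu_surplus B t = menu_surplus (bundles n) t"
proof (rule antisym)
  have fin: "finite B" using assms(1) by (rule finite_subset) simp
  show "menu_surplus B t \<le> menu_surplus (bundles n) t"
    unfolding menu_surplus_def using assms empty_in_cover[of B] by (intro Max_mono) auto
  show "menu_surplus (bundles n) t \<le> menu_surplus B t"
    unfolding menu_surplus_def[of "bundles n"]
  proof (rule Max.boundedI)
    fix x assume "x \<in> (\<lambda>b. \<phi> b t) ` bundles n"
    then obtain c where c: "c \<in> B" "x \<le> \<phi> c t" using assms unfolding covers_def by blast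
    then have "\<phi> c t \<le> menu_surplus B t" unfolding menu_surplus_def using fin by simp
    then show "x \<le> menu_surplus B t" using c by simp
  qed (use finite_bundles empty_in_bundles in \<open>blast intro: finite_imageI\<close>)+
qed

section \<open>Implementing a nested minimal cover\<close>

context
  fixes B
  assumes min: "minimal_cover B" and nested: "nested_menu B"
begin

lemma B_bundles: "B \<subseteq> bundles n" and B_covers: "covers B" and B_finite: "finite B"
  using min by (auto simp: minimal_cover_def intro: finite_subset)

text \<open>The smaller bundle is strictly better in virtual value at some \<open>t\<close>. Were
  the value difference decreasing, \<open>\<phi> c t - \<phi> b t\<close> would be at least
  \<open>v c t - v b t\<close>, hence at least the nonnegative difference at
  \<open>hi\<close>.\<close>

lemma nested_value_diff_mono:
  assumes "b \<in> B" "c \<in> B" "b \<subseteq> c"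
  shows "mono_on T (\<lambda>t. v c t - v b t)"
proof (cases "b = c")
  case False
  obtain t where t: "t \<in> T" "\<phi> c t < \<phi> b t"
    using minimal_cover_best[OF min assms(1)] assms(2) False by metis
  have bc: "b \<in> bundles n" "c \<in> bundles n" using assms B_bundles by auto
  show ?thesis
  proof (rule ccontr)
    assume "\<not> mono_on T (\<lambda>t. v c t - v b t)"
    then have anti: "antimono_on T (\<lambda>t. v c t - v b t)"
      using value_diff_monotonic[OF bc(2,1)] by (auto simp: monotonic_on_def)
    then have "mono_on T (\<lambda>t. v b t - v c t)" by (fastforce simp: monotone_on_def)
    from deriv_diff_nonneg[OF bc(2,1) t(1) this] hazard_nonneg[OF t(1)]
    have "(1 - F t) / f t * dv c t \<le> (1 - F t) / f t * dv b t"
      by (rule mult_left_mono)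
    moreover have "v c hi - v b hi \<le> v c t - v b t"
      using monotone_onD[OF anti t(1) hi_in_T] t(1) by simp
    moreover have "v b hi \<le> v c hi" using bc assms(3) by (rule value_hi_mono)
    ultimately show False using t(2) by (simp add: virtual_value_def)
  qed
qed (simp add: monotone_on_def)

text \<open>\<open>\<phi> c - \<phi> b\<close> is negative where \<open>b\<close> is uniquely best
  and nonnegative at \<open>hi\<close>, which fixes the direction of single crossing.\<close>

lemma nested_virtual_value_diff_upward:
  assumes "b \<in> B" "c \<in> B" "b \<subseteq> c" "s \<in> T" "t \<in> T" "s \<le> t" "\<phi> b s \<le> \<phi> c s"
  shows "\<phi> b t \<le> \<phi> c t"
proof (cases "b = c")
  case False
  obtain r where r: "r \<in> T" "\<phi> c r < \<phi> b r"
    using minimal_cover_best[OF min assms(1)] assms(2) False by metis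
  have bc: "b \<in> bundles n" "c \<in> bundles n" using assms B_bundles by auto
  have "mono_on T (\<lambda>t. sgn (\<phi> c t - \<phi> b t))"
    using bc r value_hi_mono[OF bc assms(3)] hi_in_T
    by (intro single_crossing_on_upward[OF bundle_single_crossing, of _ _ r hi]) auto
  from sgn_mono_nonneg[OF this assms(4-6)] assms(7) show ?thesis by simp
qed simp

text \<open>The nested maximizers of the virtual value form a chain, so their union is the largest one.\<close>

definition best :: "real \<Rightarrow> nat set" where
  "best t = \<Union> {b \<in> B. \<forall>c\<in>B. \<phi> c t \<le> \<phi> b t}"

lemma best_in: "best t \<in> B" and best_max: "c \<in> B \<Longrightarrow> \<phi> c t \<le> \<phi> (best t) t"
proof -
  have ne: "B \<noteq> {}" using empty_in_cover[OF B_bundles B_covers] by auto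
  have "Max ((\<lambda>b. \<phi> b t) ` B) \<in> (\<lambda>b. \<phi> b t) ` B"
    using ne B_finite by (intro Max_in) auto
  then obtain b where "b \<in> B" "\<phi> b t = Max ((\<lambda>b. \<phi> b t) ` B)" by auto
  then have "b \<in> {b \<in> B. \<forall>c\<in>B. \<phi> c t \<le> \<phi> b t}" using B_finite by simp
  then have "best t \<in> {b \<in> B. \<forall>c\<in>B. \<phi> c t \<le> \<phi> b t}"
    unfolding best_def using B_finite nested
    by (intro Union_in_finite_chain) (auto simp: nested_menu_def)
  then show "best t \<in> B" "c \<in> B \<Longrightarrow> \<phi> c t \<le> \<phi> (best t) t" by auto
qed

lemma best_bundle: "best t \<in> bundles n"
  using best_in B_bundles by blast

text \<open>If the choice shrank from \<open>s\<close> to \<open>t\<close>, the larger bundle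
  \<open>best s\<close> would still be a maximizer at \<open>t\<close> and so part of the union that
  defines \<open>best t\<close>.\<close>

lemma best_mono:
  assumes "s \<in> T" "t \<in> T" "s \<le> t"
  shows "best s \<subseteq> best t"
proof (rule ccontr)
  assume "\<not> best s \<subseteq> best t"
  then have sub: "best t \<subseteq> best s"
    using nested best_in by (auto simp: nested_menu_def)
  have "\<phi> (best t) t \<le> \<phi> (best s) t"
    by (rule nested_virtual_value_diff_upward[OF best_in best_in sub assms best_max[OF best_in]])
  then have "\<forall>c\<in>B. \<phi> c t \<le> \<phi> (best s) t" using best_max order_trans by blast
  then have "best s \<subseteq> best t" unfolding best_def[of t] using best_in by blast
  with \<open>\<not> best s \<subseteq> best t\<close> show False by simp
qed

text \<open>Cardinality identifies a member of a chain of finite sets, so measurability reduces to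
  that of the monotone function \<open>card (best t)\<close>.\<close>

lemma best_allocation: "allocation (\<lambda>t. return_pmf (best t))"
  unfolding allocation_def
proof (intro conjI ballI)
  fix b assume b: "b \<in> bundles n"
  have fin: "finite c" if "c \<in> bundles n" for c
    using that by (auto simp: bundles_def intro: finite_subset)
  show "(\<lambda>t. pmf (return_pmf (best t)) b) \<in> borel_measurable (restrict_space borel T)"
  proof (cases "b \<in> B")
    case True
    have "mono_on T (\<lambda>t. real (card (best t)))"
      by (intro mono_onI) (simp add: best_mono card_mono fin[OF best_bundle])
    then have [measurable]: "(\<lambda>t. real (card (best t))) \<in> borel_measurable (restrict_space borel T)"
      by (rule borel_measurable_mono_on_fnc)
    have "best t = b \<longleftrightarrow> real (card (best t)) = real (card b)" for t
      using nested True best_in[of t] fin[OF b] fin[OF best_bundle[of t]]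
      unfolding nested_menu_def by (metis card_subset_eq of_nat_eq_iff)
    then have "(\<lambda>t. pmf (return_pmf (best t)) b) =
        (\<lambda>t. if real (card (best t)) = real (card b) then 1 else 0)"
      by (auto simp: pmf_return)
    then show ?thesis by (simp del: of_nat_eq_iff)
  next
    case False
    then have "best t \<noteq> b" for t using best_in[of t] by auto
    then have "(\<lambda>t. pmf (return_pmf (best t)) b) = (\<lambda>t. 0)"
      by (simp add: pmf_return)
    then show ?thesis by simp
  qed
qed (use best_bundle in \<open>simp add: stochastic_bundles_def\<close>)

definition price :: "real \<Rightarrow> real" where
  "price t = v (best t) t - rent (\<lambda>t. return_pmf (best t)) t"

lemma integral_deriv:
  assumes "b \<in> bundles n" "s \<in> T" "t \<in> T" "s \<le> t"
  shows "(dv b has_integral v b t - v b s) {s..t}"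
  using assms
  by (intro fundamental_theorem_of_calculus)
    (auto simp: has_real_derivative_iff_has_vector_derivative[symmetric]
      intro!: DERIV_subset[OF value_has_derivative])

text \<open>Marginal values increase along the chain and \<open>best\<close> increases in the type,
  so \<open>dv (best s) s\<close> is at least \<open>dv (best t') s\<close> above the report
  \<open>t'\<close> and at most that below it. Either way the integrated difference makes
  misreporting unprofitable.\<close>

lemma price_incentive_compatible:
  assumes "t \<in> T" "t' \<in> T"
  shows "v (best t') t - price t' \<le> v (best t) t - price t"
proof -
  let ?m = "\<lambda>s. dv (best s) s"
  have m: "?m integrable_on T"
    using set_borel_integral_eq_integral(1)[OF marginal_rent_integrable[OF best_allocation]] by simp
  have sub: "?m integrable_on {r..s}" if "r \<in> T" "s \<in> T" for r s
    using that by (intro integrable_subinterval_real[OF m]) auto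
  have rent: "rent (\<lambda>t. return_pmf (best t)) s - rent (\<lambda>t. return_pmf (best t)) r = integral {r..s} ?m"
    if "r \<in> T" "s \<in> T" "r \<le> s" for r s
    using Henstock_Kurzweil_Integration.integral_combine[of lo r s ?m] sub[OF lo_in_T that(2)] that
    by (simp add: rent_def)
  have le: "dv b s \<le> dv c s" if "b \<in> B" "c \<in> B" "b \<subseteq> c" "s \<in> T" for b c s
    using that B_bundles nested_value_diff_mono by (intro deriv_diff_nonneg) auto
  show ?thesis
  proof (cases "t' \<le> t")
    case True
    have "v (best t') t - v (best t') t' \<le> integral {t'..t} ?m"
    proof (rule has_integral_le[OF integral_deriv integrable_integral])
      fix s assume "s \<in> {t'..t}"
      then show "dv (best t') s \<le> ?m s" using assms by (intro le best_in best_mono) auto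
    qed (use assms True best_bundle sub in auto)
    then show ?thesis using rent[OF assms(2,1) True] by (simp add: price_def)
  next
    case False
    then have tt: "t \<le> t'" by simp
    have "integral {t..t'} ?m \<le> v (best t') t' - v (best t') t"
    proof (rule has_integral_le[OF integrable_integral integral_deriv])
      fix s assume "s \<in> {t..t'}"
      then show "?m s \<le> dv (best t') s" using assms by (intro le best_in best_mono) auto
    qed (use assms tt best_bundle sub in auto)
    then show ?thesis using rent[OF assms tt] by (simp add: price_def)
  qed
qed

lemma price_integrable: "set_integrable lborel T price"
proof -
  have "set_integrable lborel T (\<lambda>t. expected v (return_pmf (best t)) t - rent (\<lambda>t. return_pmf (best t)) t)"
    by (intro set_integral_diff expected_allocation_integrable borel_integrable_atLeastAtMost'
        rent_continuous best_allocation value_continuous)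
  then show ?thesis by (simp add: price_def[abs_def])
qed

text \<open>The utility left to the buyer is the rent, whose integrand is at least the zero marginal
  value of the empty bundle.\<close>

lemma price_le_value:
  assumes "t \<in> T"
  shows "price t \<le> v (best t) t"
proof -
  have e: "{} \<in> B" using empty_in_cover[OF B_bundles B_covers] .
  have "v {} t - v {} lo \<le> integral {lo..t} (\<lambda>s. dv (best s) s)"
  proof (rule has_integral_le[OF integral_deriv integrable_integral])
    show "(\<lambda>s. dv (best s) s) integrable_on {lo..t}"
      using set_borel_integral_eq_integral(1)[OF marginal_rent_integrable[OF best_allocation]] assms
      by (auto intro: integrable_subinterval_real[where a=lo and b=hi])
    fix s assume "s \<in> {lo..t}"
    then show "dv {} s \<le> dv (best s) s"
      using assms nested_value_diff_mono[OF e best_in] best_bundle by (intro deriv_diff_nonneg) auto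
  qed (use assms in auto)
  then show ?thesis
    using value_empty assms lo_in_T by (simp add: price_def rent_def)
qed

lemma best_price_feasible: "feasible_mechanism n lo hi v (\<lambda>t. return_pmf (best t)) price"
proof -
  have "price \<in> borel_measurable (restrict_space borel T)"
    using price_integrable by (auto simp: set_integrable_def borel_measurable_restrict_space_iff)
  then show ?thesis
    using best_allocation price_incentive_compatible price_le_value
    by (simp add: feasible_mechanism_def mechanism_def allocation_def incentive_compatible_def
        individually_rational_def)
qed

lemma revenue_best_price: "revenue lo hi f price = integral T (\<lambda>t. f t * menu_surplus (bundles n) t)"
proof -
  have "revenue lo hi f price = integral T (\<lambda>t. f t * \<phi> (best t) t)"
    using integral_virtual_surplus[OF best_allocation]
    by (simp add: revenue_eq_integral[OF price_integrable] price_def)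
  also have "\<dots> = integral T (\<lambda>t. f t * menu_surplus (bundles n) t)"
  proof (rule Henstock_Kurzweil_Integration.integral_cong)
    fix t assume t: "t \<in> T"
    have "menu_surplus B t = \<phi> (best t) t"
      unfolding menu_surplus_def using best_in best_max B_finite by (intro Max_eqI) auto
    then show "f t * \<phi> (best t) t = f t * menu_surplus (bundles n) t"
      using menu_surplus_cover[OF B_bundles B_covers t] by simp
  qed
  finally show ?thesis .
qed

lemma nested_minimal_cover_optimal: "optimal_menu n lo hi f v B"
proof -
  have "revenue lo hi f p' \<le> revenue lo hi f price" if "feasible_mechanism n lo hi v a' p'" for a' p'
    unfolding revenue_best_price
    using feasible_revenue_le_menu_surplus[OF that subset_refl] feasible_allocation[OF that]
    by (auto simp: allocation_def stochastic_bundles_def)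
  then have "optimal_mechanism n lo hi f v (\<lambda>t. return_pmf (best t)) price"
    using best_price_feasible by (simp add: optimal_mechanism_def)
  then show ?thesis
    unfolding optimal_menu_def using B_bundles best_in by blast
qed

text \<open>\<open>B\<close> supplies a mechanism that attains the upper bound, which an optimal
  mechanism must match. The density-weighted shortfall of \<open>menu_surplus C\<close> is thus
  continuous, nonnegative and of integral zero, and vanishes at every type, not just almost
  everywhere.\<close>

lemma optimal_menu_covers:
  assumes opt: "optimal_menu n lo hi f v C"
  shows "covers C"
proof -
  obtain a p where C: "C \<subseteq> bundles n" and ap: "optimal_mechanism n lo hi f v a p"
    and aC: "\<And>t. t \<in> T \<Longrightarrow> a t \<in> return_pmf ` C"
    using opt by (auto simp: optimal_menu_def)
  have ne: "C \<noteq> {}" using aC[OF lo_in_T] by auto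
  have sub: "set_pmf (a t) \<subseteq> C" if "t \<in> T" for t using aC[OF that] by auto
  let ?gap = "\<lambda>t. f t * (menu_surplus (bundles n) t - menu_surplus C t)"
  have cont: "continuous_on T (menu_surplus (bundles n))" "continuous_on T (menu_surplus C)"
    using C ne by (auto intro!: menu_surplus_continuous intro: empty_in_bundles)
  have fin: "finite C" using C by (rule finite_subset) simp
  have le: "menu_surplus C t \<le> menu_surplus (bundles n) t" for t
    unfolding menu_surplus_def using C ne by (intro Max_mono) auto
  have "integral T (\<lambda>t. f t * menu_surplus (bundles n) t) \<le> revenue lo hi f p"
    using ap best_price_feasible by (auto simp: optimal_mechanism_def revenue_best_price[symmetric])
  also have "\<dots> \<le> integral T (\<lambda>t. f t * menu_surplus C t)"
    using ap C sub by (intro feasible_revenue_le_menu_surplus) (auto simp: optimal_mechanism_def)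
  finally have "integral T ?gap \<le> 0"
    using cont density_continuous unfolding right_diff_distrib
    by (subst integral_diff) (auto intro!: integrable_continuous_interval continuous_intros)
  moreover have gap: "0 \<le> ?gap t" if "t \<in> T" for t
    using le density_pos that by (auto simp: less_imp_le)
  moreover have cgap: "continuous_on T ?gap"
    by (intro continuous_intros density_continuous cont)
  ultimately have "integral T ?gap = 0"
    using integral_nonneg[OF integrable_continuous_interval[OF cgap]] by fastforce
  then have "?gap t = 0" if "t \<in> T" for t
    using integral_eq_0_iff[OF cgap lo_less_hi gap] that by blast
  then have eq: "menu_surplus C t = menu_surplus (bundles n) t" if "t \<in> T" for t
    using density_pos that by force
  show ?thesis
    unfolding covers_def
  proof (intro ballI)
    fix t b assume t: "t \<in> T" and b: "b \<in> bundles n"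
    have "\<phi> b t \<le> menu_surplus C t"
      unfolding eq[OF t] unfolding menu_surplus_def using b by (intro Max_ge) auto
    moreover have "menu_surplus C t \<in> (\<lambda>c. \<phi> c t) ` C"
      unfolding menu_surplus_def using fin ne by (intro Max_in) auto
    ultimately show "\<exists>c\<in>C. \<phi> b t \<le> \<phi> c t" by auto
  qed
qed

end

text \<open>Since \<open>\<phi> {}\<close> vanishes, the weight of the empty bundle is free and can be used to make the weights
  sum to zero; a small multiple is then the difference of two stochastic bundles.\<close>

lemma linear_combination_single_crossing:
  "single_crossing_on T (\<lambda>t. \<Sum>b\<in>bundles n. w b * \<phi> b t)"
proof -
  let ?B = "bundles n"
  define w' where "w' = w({} := - (\<Sum>b\<in>?B - {{}}. w b))"
  define N where "N = real (card ?B)"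
  \<comment> \<open>\<open>K\<close> exceeds every \<open>\<bar>w' b\<bar>\<close>, so tilting the
    uniform weights \<open>1 / N\<close> by \<open>w' b / (N * K)\<close> keeps them
    nonnegative.\<close>
  define K where "K = 1 + (\<Sum>b\<in>?B. \<bar>w' b\<bar>)"
  have B: "?B = insert {} (?B - {{}})" by auto
  have w'0: "(\<Sum>b\<in>?B. w' b) = 0"
    by (subst B, subst sum.insert) (auto simp: w'_def)
  have N: "0 < N" unfolding N_def using empty_in_bundles finite_bundles by (metis card_gt_0_iff empty_iff of_nat_0_less_iff)
  have K: "0 < K" unfolding K_def by (intro add_pos_nonneg sum_nonneg) auto
  have wK: "- K \<le> w' b" if "b \<in> ?B" for b
    using member_le_sum[of b ?B "\<lambda>b. \<bar>w' b\<bar>"] that unfolding K_def by auto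
  obtain a where a: "set_pmf a \<subseteq> ?B" "\<And>b. b \<in> ?B \<Longrightarrow> pmf a b = 1 / N + w' b / (N * K)"
  proof (rule pmf_of_weights)
    show "0 \<le> 1 / N + w' b / (N * K)" if "b \<in> ?B" for b
      using wK[OF that] N K by (simp add: field_simps)
    show "(\<Sum>b\<in>?B. 1 / N + w' b / (N * K)) = 1"
      using N w'0 empty_in_bundles[of n] by (auto simp: sum.distrib sum_divide_distrib[symmetric] N_def)
  qed auto
  obtain c where c: "set_pmf c \<subseteq> ?B" "\<And>b. b \<in> ?B \<Longrightarrow> pmf c b = 1 / N"
    using N by (rule_tac pmf_of_weights[of ?B "\<lambda>_. 1 / N"]) (auto simp: N_def)
  have st: "a \<in> stochastic_bundles n" "c \<in> stochastic_bundles n"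
    using a c by (auto simp: stochastic_bundles_def)
  have diff: "expected \<phi> a t - expected \<phi> c t = (\<Sum>b\<in>?B. w b * \<phi> b t) / (N * K)" if t: "t \<in> T" for t
  proof -
    have "expected \<phi> a t - expected \<phi> c t = (\<Sum>b\<in>?B. w' b * \<phi> b t) / (N * K)"
      unfolding expected_eq_sum[OF st(1)] expected_eq_sum[OF st(2)] sum_subtractf[symmetric] sum_divide_distrib
      using a(2) c(2) by (intro sum.cong) (auto simp: algebra_simps)
    also have "(\<Sum>b\<in>?B. w' b * \<phi> b t) = (\<Sum>b\<in>?B. w b * \<phi> b t)"
      using t by (intro sum.cong) (auto simp: w'_def)
    finally show ?thesis .
  qed
  have "sgn (expected \<phi> a t - expected \<phi> c t) = sgn (\<Sum>b\<in>?B. w b * \<phi> b t)" if "t \<in> T" for t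
    using N K unfolding diff[OF that] by (simp add: sgn_divide sgn_mult)
  then show ?thesis
    using stochastic_single_crossing[OF st]
    by (auto simp: single_crossing_on_def monotonic_on_def monotone_on_def)
qed

lemma three_bundles_single_crossing:
  assumes "b \<in> bundles n" "c \<in> bundles n" "d \<in> bundles n"
  shows "single_crossing_on T (\<lambda>t. x * \<phi> b t + y * \<phi> c t + z * \<phi> d t)"
proof -
  \<comment> \<open>Adding up conditionals lets coinciding bundles pool their weights.\<close>
  let ?w = "\<lambda>e. (if e = b then x else 0) + (if e = c then y else 0) + (if e = d then z else 0)"
  have "(\<Sum>e\<in>bundles n. ?w e * \<phi> e t) = x * \<phi> b t + y * \<phi> c t + z * \<phi> d t" for t
    using assms by (simp add: distrib_right sum.distrib if_distrib[of "\<lambda>x. x * _"] cong: if_cong)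
  then show ?thesis using linear_combination_single_crossing[of ?w] by simp
qed

end

section \<open>The union quantity condition\<close>

locale union_quantity_environment = single_crossing_environment +
  fixes Q :: "nat set \<Rightarrow> real"
  assumes sold_alone: "\<And>b. b \<in> bundles n \<Longrightarrow> sold_alone_quantity lo hi f v b (Q b)"
    and union_quantity: "\<And>b c. b \<in> bundles n \<Longrightarrow> c \<in> bundles n \<Longrightarrow> min (Q b) (Q c) \<le> Q (b \<union> c)"
begin

text \<open>A larger sold-alone quantity means an earlier zero, because \<open>F\<close> is strictly
  increasing; from there on the virtual value of \<open>u\<close> is nonnegative.\<close>

lemma larger_quantity_crosses_earlier:
  assumes "b \<in> bundles n" "u \<in> bundles n" "u \<noteq> {}" "Q b \<le> Q u"
  obtains r where "r \<in> T" "\<phi> b r = 0" "0 \<le> \<phi> u r"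
proof -
  obtain r where r: "r \<in> T" "\<phi> b r = 0" "Q b = 1 - F r"
    using sold_alone[OF assms(1)] by (auto simp: sold_alone_quantity_def)
  obtain s where s: "s \<in> T" "\<phi> u s = 0" "Q u = 1 - F s"
    using sold_alone[OF assms(2)] by (auto simp: sold_alone_quantity_def)
  have "s \<le> r" using assms(4) r s cdf_le_iff by auto
  then have "0 \<le> \<phi> u r"
    using sgn_mono_nonneg[OF virtual_value_upward[OF assms(2,3)] s(1) r(1)] s(2) by simp
  then show thesis using r that by blast
qed

lemma virtual_value_le_larger:
  assumes b: "b \<in> bundles n" "b \<noteq> {}" and u: "u \<in> bundles n" "b \<subseteq> u" "Q b \<le> Q u" and t: "t \<in> T"
  shows "\<phi> b t \<le> max 0 (\<phi> u t)"
proof (rule ccontr)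
  assume "\<not> \<phi> b t \<le> max 0 (\<phi> u t)"
  then have bt: "0 < \<phi> b t" "\<phi> u t < \<phi> b t" by auto
  have "u \<noteq> {}" using b u by auto
  then obtain r where r: "r \<in> T" "\<phi> b r = 0" "0 \<le> \<phi> u r"
    using larger_quantity_crosses_earlier b u by metis
  \<comment> \<open>\<open>\<phi> u - \<phi> b\<close> is assumed negative at \<open>t\<close>, yet
    it is nonnegative at \<open>r\<close>, which precedes \<open>t\<close>, and at
    \<open>hi\<close>.\<close>
  have "r \<le> t"
    using sgn_mono_pos[OF virtual_value_upward[OF b] t r(1)] bt r(2) by force
  have "mono_on T (\<lambda>t. sgn (\<phi> u t - \<phi> b t))"
    using t hi_in_T bt value_hi_mono[OF b(1) u(1,2)]
    by (intro single_crossing_on_upward[OF bundle_single_crossing[OF u(1) b(1)], of t hi]) auto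
  from sgn_mono_nonneg[OF this r(1) t \<open>r \<le> t\<close>] r bt show False by simp
qed

text \<open>The ordering of quantities makes \<open>b2\<close> the member that the union ties with.
  The sign of \<open>g\<close> at the zero \<open>r\<close> of \<open>\<phi> b2\<close> then decides
  which of two contradictions arises.\<close>

lemma minimal_cover_ordered:
  assumes min: "minimal_cover B" and b: "b1 \<in> B" "b2 \<in> B" and Q: "Q b2 \<le> Q b1"
  shows "b1 \<subseteq> b2 \<or> b2 \<subseteq> b1"
proof (rule ccontr)
  assume incomparable: "\<not> (b1 \<subseteq> b2 \<or> b2 \<subseteq> b1)"
  then have ne: "b1 \<noteq> {}" "b2 \<noteq> {}" "b1 \<noteq> b2" by auto
  have B: "B \<subseteq> bundles n" "covers B" using min by (auto simp: minimal_cover_def)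
  have bb: "b1 \<in> bundles n" "b2 \<in> bundles n" using B b by auto
  have emp: "{} \<in> B" by (rule empty_in_cover[OF B])
  obtain t1 where t1: "t1 \<in> T" and best1: "\<And>d. d \<in> B \<Longrightarrow> d \<noteq> b1 \<Longrightarrow> \<phi> d t1 < \<phi> b1 t1"
    using minimal_cover_best[OF min b(1)] by metis
  obtain t2 where t2: "t2 \<in> T" and best2: "\<And>d. d \<in> B \<Longrightarrow> d \<noteq> b2 \<Longrightarrow> \<phi> d t2 < \<phi> b2 t2"
    using minimal_cover_best[OF min b(2)] by metis
  have pos1: "0 < \<phi> b1 t1" using best1[OF emp] ne t1 by simp
  have pos2: "0 < \<phi> b2 t2" using best2[OF emp] ne t2 by simp
  note up1 = virtual_value_upward[OF bb(1) ne(1)] and up2 = virtual_value_upward[OF bb(2) ne(2)]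
  define u where "u = b1 \<union> b2"
  have u: "u \<in> bundles n" "b2 \<subseteq> u" "u \<noteq> {}" "u \<noteq> b2"
    using bb ne incomparable by (auto simp: u_def bundles_def)
  have Qu: "Q b2 \<le> Q u" using union_quantity[OF bb] Q by (simp add: u_def)
  define g where "g = (\<lambda>t. \<phi> u t - \<phi> b2 t)"
  have gsc: "single_crossing_on T g"
    unfolding g_def using u(1) bb(2) by (rule bundle_single_crossing)
  have ghi: "0 \<le> g hi" using value_hi_mono[OF bb(2) u(1,2)] by (simp add: g_def)
  \<comment> \<open>Covering and the unique optimality of \<open>b2\<close> at \<open>t2\<close>
    bound \<open>g\<close> above; the quantity comparison bounds it below.\<close>
  have gt2: "g t2 = 0"
  proof (rule antisym)
    obtain c where "c \<in> B" "\<phi> u t2 \<le> \<phi> c t2" using B(2) u(1) t2 unfolding covers_def by blast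
    then show "g t2 \<le> 0" using best2[of c] by (cases "c = b2") (auto simp: g_def)
    show "0 \<le> g t2"
      using virtual_value_le_larger[OF bb(2) ne(2) u(1,2) Qu t2] pos2 by (auto simp: g_def max_def split: if_splits)
  qed
  obtain r where r: "r \<in> T" "\<phi> b2 r = 0" and gr: "0 \<le> g r"
    using larger_quantity_crosses_earlier[OF bb(2) u(1) u(3) Qu] by (force simp: g_def)
  have rt2: "r < t2" using sgn_mono_pos[OF up2 t2 r(1)] pos2 r(2) by force
  \<comment> \<open>Distinct bundles have distinct virtual values, so \<open>g\<close> is not
    identically zero, as \<open>proportional_at_zeros\<close> requires.\<close>
  obtain w where w: "w \<in> T" "g w \<noteq> 0"
    using virtual_value_distinct u bb by (force simp: g_def)
  \<comment> \<open>At a zero \<open>s\<close> of \<open>g\<close>, all virtual values are those at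
    \<open>t2\<close> scaled by the common factor \<open>\<phi> b2 s / \<phi> b2 t2\<close>.\<close>
  have proportional: "\<phi> c s * \<phi> b2 t2 = \<phi> c t2 * \<phi> b2 s"
    if c: "c \<in> bundles n" and s: "s \<in> T" "g s = 0" for c s
  proof (rule proportional_at_zeros[where g=g and S=T and lo=lo and hi=hi])
    fix x y z t assume t: "t \<in> T"
    let ?h = "\<lambda>t. x * \<phi> u t + y * \<phi> c t + (z - x) * \<phi> b2 t"
    have h: "x * g t + y * \<phi> c t + z * \<phi> b2 t = ?h t" for t
      by (simp add: g_def algebra_simps)
    assume "x * g lo + y * \<phi> c lo + z * \<phi> b2 lo = 0" "x * g hi + y * \<phi> c hi + z * \<phi> b2 hi = 0"
    then show "x * g t + y * \<phi> c t + z * \<phi> b2 t = 0"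
      unfolding h using t lo_in_T hi_in_T
      by (intro single_crossing_on_zero_between[OF three_bundles_single_crossing[OF u(1) c bb(2)], of lo t hi]) auto
  qed (use w t2 gt2 s in auto)
  show False
  proof (cases "g r = 0")
    case True
    \<comment> \<open>Then \<open>b1\<close> and \<open>b2\<close> cross zero together at \<open>r\<close> and are proportional from there on, so one of
      them is never the unique best bundle.\<close>
    have r1: "\<phi> b1 r = 0" using proportional[OF bb(1) r(1) True] r(2) pos2 by simp
    then have rt1: "r < t1" using sgn_mono_pos[OF up1 t1 r(1)] pos1 by force
    \<comment> \<open>With \<open>m\<close> above both witnesses, a combination of
      \<open>\<phi> b1\<close> and \<open>\<phi> b2\<close> that vanishes at \<open>r\<close> and
      \<open>m\<close> vanishes at \<open>t1\<close> and \<open>t2\<close> as well.\<close>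
    define m where "m = max t1 t2"
    have m: "m \<in> T" "r < m" "t1 \<le> m" "t2 \<le> m" using t1 t2 rt2 by (auto simp: m_def)
    have pm: "0 < \<phi> b1 m" "0 < \<phi> b2 m"
      using sgn_mono_pos[OF up1 t1 m(1)] sgn_mono_pos[OF up2 t2 m(1)] pos1 pos2 m by auto
    have h: "\<phi> b2 m * \<phi> b1 s + (- \<phi> b1 m) * \<phi> b2 s + 0 * \<phi> b2 s = 0" if "r \<le> s" "s \<le> m" "s \<in> T" for s
      using r r1 m that
      by (intro single_crossing_on_zero_between[OF three_bundles_single_crossing[OF bb(1,2,2)], of r s m]) auto
    have "\<phi> b2 m * \<phi> b1 t1 = \<phi> b1 m * \<phi> b2 t1" "\<phi> b2 m * \<phi> b1 t2 = \<phi> b1 m * \<phi> b2 t2"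
      using h[of t1] h[of t2] m t1 t2 rt1 rt2 by auto
    moreover have "\<phi> b2 m * \<phi> b1 t2 < \<phi> b2 m * \<phi> b2 t2"
      using pm best2[OF b(1)] ne(3) by simp
    moreover have "\<phi> b1 m * \<phi> b2 t1 < \<phi> b1 m * \<phi> b1 t1"
      using pm best1[OF b(2)] ne(3) by simp
    \<comment> \<open>After cancelling the positive factors these compare \<open>\<phi> b1 m\<close>
      and \<open>\<phi> b2 m\<close> strictly in both directions.\<close>
    ultimately have "\<phi> b1 m * \<phi> b2 t2 < \<phi> b2 m * \<phi> b2 t2" "\<phi> b2 m * \<phi> b1 t1 < \<phi> b1 m * \<phi> b1 t1"
      by argo+
    then show False using pos1 pos2 by simp
  next
    case False
    \<comment> \<open>Then \<open>g\<close> falls to zero at some \<open>l \<le> t2\<close> where \<open>b2\<close> is still the unique best bundle in \<open>B\<close>.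
      Just below \<open>l\<close> the union is strictly better than \<open>b2\<close>, hence than all of \<open>B\<close>.\<close>
    then have "0 < g r" using gr by simp
    have down: "mono_on T (\<lambda>t. sgn (- g t))"
      using gsc
    proof (cases rule: single_crossing_on_cases)
      case 1
      then show ?thesis using sgn_mono_pos[OF 1 r(1) t2] \<open>0 < g r\<close> rt2 gt2 by simp
    qed
    \<comment> \<open>A negative value would persist up to \<open>hi\<close>, against
      \<open>ghi\<close>.\<close>
    have gnn: "0 \<le> g t" if "t \<in> T" for t
    proof (rule ccontr)
      assume "\<not> 0 \<le> g t"
      then show False using sgn_mono_pos[OF down that hi_in_T] that ghi by simp
    qed
    define Z where "Z = {t \<in> {r..t2}. g t = 0}"
    have cg: "continuous_on {r..t2} g"
      unfolding g_def using u bb r t2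
      by (intro continuous_intros continuous_on_subset[OF virtual_value_continuous, of _ "{r..t2}"]) auto
    have "closed Z"
      unfolding Z_def using continuous_closed_preimage_constant[OF cg, of 0] by simp
    moreover have Zb: "Z \<noteq> {}" "bdd_below Z"
      using rt2 gt2 by (auto simp: Z_def intro!: bdd_belowI[of _ r])
    ultimately have "Inf Z \<in> Z" by (intro closed_contains_Inf)
    \<comment> \<open>The first zero of \<open>g\<close> after \<open>r\<close>; it exists because
      \<open>t2\<close> is a zero.\<close>
    define l where "l = Inf Z"
    have l: "r \<le> l" "l \<le> t2" "g l = 0" using \<open>Inf Z \<in> Z\<close> by (auto simp: l_def Z_def)
    have lT: "l \<in> T" using l r t2 by auto
    have rl: "r < l" using l \<open>0 < g r\<close> by (cases "r = l") auto
    have gl: "0 < g s" if "r \<le> s" "s < l" for s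
    proof -
      have "s \<notin> Z" using cInf_lower[OF _ Zb(2), of s] that by (auto simp: l_def)
      then have "g s \<noteq> 0" using that l by (auto simp: Z_def)
      then show ?thesis using gnn[of s] that r lT by auto
    qed
    \<comment> \<open>Otherwise \<open>t1\<close> is a zero of \<open>g\<close>, and proportionality
      equates \<open>\<phi> b1 t1 * \<phi> b2 t2\<close> with the product of the cross terms, which
      are positive and strictly smaller.\<close>
    have t1l: "t1 < l"
    proof (rule ccontr)
      assume "\<not> t1 < l"
      then have "g t1 \<le> 0"
        using sgn_mono_nonneg[OF down lT t1] l(3) by simp
      then have "g t1 = 0" using gnn[OF t1] by simp
      from proportional[OF bb(1) t1 this] have eq: "\<phi> b1 t1 * \<phi> b2 t2 = \<phi> b1 t2 * \<phi> b2 t1" .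
      have lt: "\<phi> b1 t2 < \<phi> b2 t2" "\<phi> b2 t1 < \<phi> b1 t1"
        using best1[OF b(2)] best2[OF b(1)] ne(3) by auto
      have "0 < \<phi> b1 t1 * \<phi> b2 t2" using pos1 pos2 by simp
      moreover have "0 < \<phi> b1 t2 \<or> 0 < \<phi> b2 t1"
        using sgn_mono_pos[OF up1 t1 t2] sgn_mono_pos[OF up2 t2 t1] pos1 pos2 by (cases "t1 \<le> t2") auto
      ultimately have "0 < \<phi> b1 t2" "0 < \<phi> b2 t1"
        unfolding eq by (auto simp: zero_less_mult_iff)
      then have "\<phi> b1 t2 * \<phi> b2 t1 < \<phi> b2 t2 * \<phi> b1 t1"
        using lt by (intro mult_strict_mono) auto
      then show False using eq by (simp add: mult.commute)
    qed
    \<comment> \<open>Both types lie above \<open>t1\<close>, so \<open>b1\<close> is positive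
      there; proportionality carries positivity over to \<open>b2\<close> at
      \<open>l\<close>.\<close>
    have "0 < \<phi> b1 l" "0 < \<phi> b1 t2"
      using sgn_mono_pos[OF up1 t1 lT] sgn_mono_pos[OF up1 t1 t2] pos1 t1l l by auto
    then have "0 < \<phi> b1 t2 * \<phi> b2 l"
      using proportional[OF bb(1) lT l(3)] pos2 by (metis mult_pos_pos)
    then have pl: "0 < \<phi> b2 l" using \<open>0 < \<phi> b1 t2\<close> by (simp add: zero_less_mult_iff)
    \<comment> \<open>Scaling by a positive factor preserves the ranking at \<open>t2\<close>, where
      \<open>b2\<close> is uniquely best.\<close>
    have bestl: "\<phi> c l < \<phi> b2 l" if "c \<in> B - {b2}" for c
    proof -
      have "\<phi> c l * \<phi> b2 t2 = \<phi> c t2 * \<phi> b2 l" using that B by (intro proportional lT l) auto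
      also have "\<dots> < \<phi> b2 t2 * \<phi> b2 l" using that pl best2 by simp
      finally show ?thesis using pos2 by (simp add: mult.commute)
    qed
    have lim: "(\<phi> c \<longlongrightarrow> \<phi> c l) (at l within {r..<l})" if "c \<in> bundles n" for c
    proof -
      have "(\<phi> c \<longlongrightarrow> \<phi> c l) (at l within T)"
        using virtual_value_continuous[OF that] lT unfolding continuous_on_def by blast
      then show ?thesis by (rule tendsto_within_subset) (use lT r in auto)
    qed
    have "\<forall>\<^sub>F s in at l within {r..<l}. \<forall>c\<in>B-{b2}. \<phi> c s < \<phi> b2 s"
    proof (intro eventually_ball_finite ballI)
      show "finite (B - {b2})" using finite_subset[OF B(1)] by simp
      fix c assume c: "c \<in> B - {b2}"
      then have "c \<in> bundles n" using B by auto
      from tendsto_diff[OF lim[OF bb(2)] lim[OF this]]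
      have "\<forall>\<^sub>F s in at l within {r..<l}. 0 < \<phi> b2 s - \<phi> c s"
        by (rule order_tendstoD) (use bestl[OF c] in simp)
      then show "\<forall>\<^sub>F s in at l within {r..<l}. \<phi> c s < \<phi> b2 s"
        by eventually_elim simp
    qed
    moreover have "\<forall>\<^sub>F s in at l within {r..<l}. s \<in> {r..<l}"
      unfolding eventually_at_filter by simp
    moreover have "at l within {r..<l} \<noteq> bot"
      using rl by (simp add: trivial_limit_within islimpt_greaterThanLessThan2 islimpt_subset[of l "{r<..<l}"])
    ultimately have "\<exists>s. (\<forall>c\<in>B-{b2}. \<phi> c s < \<phi> b2 s) \<and> s \<in> {r..<l}"
      by (intro eventually_happens'[OF _ eventually_conj])
    then obtain s where s: "s \<in> {r..<l}" "\<And>c. c \<in> B - {b2} \<Longrightarrow> \<phi> c s < \<phi> b2 s"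
      by blast
    have sT: "s \<in> T" using s(1) r lT by auto
    obtain c where "c \<in> B" "\<phi> u s \<le> \<phi> c s"
      using B(2) u(1) sT unfolding covers_def by blast
    then have "\<phi> u s \<le> \<phi> b2 s" using s(2)[of c] by (cases "c = b2") auto
    then show False using gl[of s] s(1) by (simp add: g_def)
  qed
qed

section \<open>Optimal menus are the covering menus\<close>

lemma minimal_cover_nested:
  assumes "minimal_cover B"
  shows "nested_menu B"
  unfolding nested_menu_def
proof (intro ballI)
  fix b c assume "b \<in> B" "c \<in> B"
  then show "b \<subseteq> c \<or> c \<subseteq> b"
    using minimal_cover_ordered[OF assms] by (cases "Q c \<le> Q b") (auto dest: order.strict_implies_order simp: not_le)
qed

text \<open>A covering menu contains a minimal cover, which is nested and hence optimal, and its
  mechanism remains available on the larger menu. Conversely, a minimal cover within all bundles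
  provides the benchmark.\<close>

lemma optimal_menu_iff_covers:
  assumes "B \<subseteq> bundles n"
  shows "optimal_menu n lo hi f v B \<longleftrightarrow> covers B"
proof
  assume "covers B"
  then obtain C where C: "C \<subseteq> B" "minimal_cover C"
    using cover_contains_minimal_cover[OF assms] by metis
  have "optimal_menu n lo hi f v C"
    using nested_minimal_cover_optimal[OF C(2) minimal_cover_nested[OF C(2)]] .
  then show "optimal_menu n lo hi f v B"
    unfolding optimal_menu_def using C(1) assms by blast
next
  assume opt: "optimal_menu n lo hi f v B"
  have "covers (bundles n)" by (auto simp: covers_def)
  then obtain C where "minimal_cover C"
    using cover_contains_minimal_cover[OF subset_refl] by metis
  from optimal_menu_covers[OF this minimal_cover_nested[OF this] opt] show "covers B" .
qed

lemma minimal_optimal_menu_iff: "minimal_optimal_menu n lo hi f v B \<longleftrightarrow> minimal_cover B"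
proof
  assume min: "minimal_optimal_menu n lo hi f v B"
  then have B: "B \<subseteq> bundles n" "covers B"
    using optimal_menu_iff_covers[of B] by (auto simp: minimal_optimal_menu_def optimal_menu_def)
  have "\<not> covers (B - {c})" if "c \<in> B" for c
  proof -
    have "B - {c} \<subset> B" using that by blast
    then have "\<not> optimal_menu n lo hi f v (B - {c})"
      using min unfolding minimal_optimal_menu_def by blast
    moreover have "B - {c} \<subseteq> bundles n" using B(1) by blast
    ultimately show ?thesis using optimal_menu_iff_covers[of "B - {c}"] by simp
  qed
  then show "minimal_cover B" unfolding minimal_cover_def using B by blast
next
  assume min: "minimal_cover B"
  have "\<not> optimal_menu n lo hi f v C" if C: "C \<subset> B" for C
  proof
    assume "optimal_menu n lo hi f v C"
    moreover have "C \<subseteq> bundles n" using min C unfolding minimal_cover_def by blast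
    ultimately have "covers C" using optimal_menu_iff_covers by blast
    obtain c where "c \<in> B" "c \<notin> C" using C by auto
    then have "C \<subseteq> B - {c}" using C by auto
    with \<open>covers C\<close> have "covers (B - {c})" by (rule covers_mono)
    then show False using min \<open>c \<in> B\<close> unfolding minimal_cover_def by blast
  qed
  then have below: "\<forall>C. C \<subset> B \<longrightarrow> \<not> optimal_menu n lo hi f v C" by blast
  have B: "B \<subseteq> bundles n" "covers B" using min unfolding minimal_cover_def by blast+
  have "optimal_menu n lo hi f v B" using B(2) unfolding optimal_menu_iff_covers[OF B(1)] .
  then show "minimal_optimal_menu n lo hi f v B"
    unfolding minimal_optimal_menu_def using below by (rule conjI)
qed

text \<open>Inductively the union so far sells at least \<open>Q (b k)\<close>, which by the
  ordering is at least \<open>Q (b (Suc k))\<close>; the next bundle thus attains the minimum in the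
  union quantity condition.\<close>

lemma cumulative_union_quantity:
  fixes m k :: nat
  assumes b: "\<And>i. i \<in> {1..m} \<Longrightarrow> b i \<in> bundles n"
    and ord: "\<And>i j. i \<in> {1..m} \<Longrightarrow> j \<in> {1..m} \<Longrightarrow> i \<le> j \<Longrightarrow> Q (b j) \<le> Q (b i)"
    and k: "1 \<le> k" "k \<le> m"
  shows "(\<Union>i\<in>{1..k}. b i) \<in> bundles n \<and> Q (b k) \<le> Q (\<Union>i\<in>{1..k}. b i)"
  using k
proof (induction k rule: dec_induct)
  case base
  then show ?case using b[of 1] by simp
next
  case (step k)
  let ?U = "\<Union>i\<in>{1..k}. b i"
  have IH: "?U \<in> bundles n" "Q (b k) \<le> Q ?U" using step by auto
  have k: "b (Suc k) \<in> bundles n" using step b by auto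
  have "Q (b (Suc k)) \<le> Q (b k)" using step by (intro ord) auto
  then have "Q (b (Suc k)) \<le> Q (?U \<union> b (Suc k))"
    using union_quantity[OF IH(1) k] IH(2) by linarith
  moreover have "?U \<union> b (Suc k) \<in> bundles n"
    using IH(1) k by (auto simp: bundles_def)
  moreover have "(\<Union>i\<in>{1..Suc k}. b i) = ?U \<union> b (Suc k)"
    using step by (auto simp: atLeastAtMostSuc_conv)
  ultimately show ?case by simp
qed

text \<open>A nonempty bundle \<open>b k\<close> lies in the k-th union and sells no more than it,
  so at each type the union or the empty bundle is at least as good.\<close>

lemma cumulative_union_menu_covers:
  fixes m :: nat
  assumes b: "b ` {1..m} = bundles n"
    and ord: "\<And>i j. i \<in> {1..m} \<Longrightarrow> j \<in> {1..m} \<Longrightarrow> i \<le> j \<Longrightarrow> Q (b j) \<le> Q (b i)"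
  shows "covers (insert {} ((\<lambda>k. \<Union>i\<in>{1..k}. b i) ` {1..m}))"
  unfolding covers_def
proof (intro ballI)
  fix t c assume t: "t \<in> T" and c: "c \<in> bundles n"
  show "\<exists>d\<in>insert {} ((\<lambda>k. \<Union>i\<in>{1..k}. b i) ` {1..m}). \<phi> c t \<le> \<phi> d t"
  proof (cases "c = {}")
    case False
    obtain k where k: "k \<in> {1..m}" "c = b k" using b c by blast
    let ?U = "\<Union>i\<in>{1..k}. b i"
    have bb: "b i \<in> bundles n" if "i \<in> {1..m}" for i using b that by blast
    have U: "?U \<in> bundles n" "Q c \<le> Q ?U"
      using cumulative_union_quantity[where b=b and k=k and m=m, OF bb ord] k by auto
    have "c \<subseteq> ?U" using k by auto
    then have "\<phi> c t \<le> max 0 (\<phi> ?U t)"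
      by (rule virtual_value_le_larger[OF c False U(1) _ U(2) t])
    then have "\<phi> c t \<le> \<phi> {} t \<or> \<phi> c t \<le> \<phi> ?U t" using t by (auto simp: max_def split: if_splits)
    then show ?thesis using k(1) by blast
  qed blast
qed

end

theorem theorem8:
  fixes n :: nat
    and lo hi :: real
    and f :: "real \<Rightarrow> real"
    and v :: "nat set \<Rightarrow> real \<Rightarrow> real"
    and Q :: "nat set \<Rightarrow> real"
    and bstar :: "nat \<Rightarrow> nat set"
  assumes env: "bundling_environment n lo hi f v"
    and A1: "\<forall>b\<in>bundles n. \<forall>b'\<in>bundles n.
        single_crossing_on {lo..hi} (\<lambda>t. virtual_value lo hi f v b t - virtual_value lo hi f v b' t) \<and>
        monotonic_on {lo..hi} (\<lambda>t. v b t - v b' t)"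
    and A2: "\<forall>a\<in>stochastic_bundles n. \<forall>a'\<in>stochastic_bundles n.
        single_crossing_on {lo..hi}
          (\<lambda>t. expected (virtual_value lo hi f v) a t - expected (virtual_value lo hi f v) a' t)"
    and value_mono: "\<forall>b\<in>bundles n. \<forall>b'\<in>bundles n. b \<subseteq> b' \<longrightarrow> v b' hi \<ge> v b hi"
    and Q: "\<forall>b\<in>bundles n. sold_alone_quantity lo hi f v b (Q b)"
    and union_quantity: "\<forall>b1\<in>bundles n. \<forall>b2\<in>bundles n. Q (b1 \<union> b2) \<ge> min (Q b1) (Q b2)"
    and bstar_enum: "bij_betw bstar {1..2 ^ n} (bundles n)"
    and bstar_ordered: "\<forall>i\<in>{1..2 ^ n}. \<forall>j\<in>{1..2 ^ n}. i \<le> j \<longrightarrow> Q (bstar i) \<ge> Q (bstar j)"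
  shows "(\<exists>B. minimal_optimal_menu n lo hi f v B) \<and>
    (\<forall>B. minimal_optimal_menu n lo hi f v B \<longrightarrow> nested_menu B) \<and>
    optimal_menu n lo hi f v (insert {} ((\<lambda>k. \<Union>i\<in>{1..k}. bstar i) ` {1..2 ^ n}))"
proof -
  interpret bundling_environment n lo hi f v by (rule env)
  interpret union_quantity_environment n lo hi f v Q
    using A1 A2 value_mono Q union_quantity by unfold_locales auto
  let ?M = "insert {} ((\<lambda>k. \<Union>i\<in>{1..k}. bstar i) ` {1..2 ^ n})"
  have img: "bstar ` {1..2 ^ n} = bundles n" using bstar_enum by (rule bij_betw_imp_surj_on)
  then have bb: "bstar i \<in> bundles n" if "i \<in> {1..2 ^ n}" for i using that by blast
  have "covers ?M"
    using img bstar_ordered by (intro cumulative_union_menu_covers) auto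
  moreover have "(\<Union>i\<in>{1..k}. bstar i) \<in> bundles n" if "k \<in> {1..2 ^ n}" for k
    using cumulative_union_quantity[of "2 ^ n" bstar k] bb bstar_ordered that by auto
  then have M: "?M \<subseteq> bundles n" by auto
  ultimately have "optimal_menu n lo hi f v ?M" using optimal_menu_iff_covers by blast
  moreover obtain C where "minimal_cover C"
    using cover_contains_minimal_cover[OF M \<open>covers ?M\<close>] by metis
  ultimately show ?thesis
    using minimal_optimal_menu_iff minimal_cover_nested by blast
qed

end
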